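(* Let $d,m,n$ be positive integers such that $n\ge d+1$. For each $w\in[n]$, let $X^w=\{x^w_1,\dots,x^w_m\}\subset\mathbb{R}^{d-1}$ be an (indexed) set of $m$ points. For every $w\in[n]$ and $i\in[m]$, let $A^w_i$ be a closed subset of $S^d$. Assume that: (1) for all $W'\subseteq[n]$ such that $|W'|\ge n-d$, we have $S^d=\bigcup_{w\in W'}\bigcup_{i=1}^m\left(A^w_i\cup(-A^w_i)\right)$; (2) for every pair of different numbers $u,w\in[n]$ and every $i\in[m]$, we have $A^u_i\cap(-A^w_i)=\emptyset$. Then there are two disjoint subsets $P_+,P_-$ of $[n]\times[m]$ such that $|P_+|+|P_-|=d+1$, the projection $\pi_1:P_+\cup P_-\to[n]$ onto the first coordinate is injective, the projection $\pi_2:P_+\cup P_-\to[m]$ onto the second coordinate satisfies $\pi_2(P_+)\cap\pi_2(P_-)=\emptyset$, and $$\operatorname{conv}\{x^w_i:(w,i)\in P_+\}\cap\operatorname{conv}\{x^w_i:(w,i)\in P_-\}\neq\emptyset.$$ Additionally, there exists $x\in S^d$ with $$x\in\left(\bigcap_{(w,i)\in P_+}A^w_i\right)\cap\left(\bigcap_{(w,i)\in P_-}(-A^w_i)\right).$$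
   Context: Notation: $[k]=\{1,\dots,k\}$; $S^d$ is the unit sphere in $\mathbb{R}^{d+1}$ and $-A=\{-x:x\in A\}$. *)

theory Defs
  imports "HOL-Analysis.Analysis" "HOL-Library.Function_Algebras"
begin

(* R^k is the carrier of Euclidean_space k: functions nat => real vanishing at all indices >= k,
   so k may be 0; nsphere d is the unit sphere of R^(d+1) in this model.
   Pointwise scaling completes the pointwise addition and negation of Function_Algebras to a real
   vector space, of which R^k is a subspace; in particular "convex hull" becomes
   available, and hulls of subsets of R^k stay in R^k. *)

instantiation "fun" :: (type, real_vector) real_vector
begin

definition scaleR_fun :: "real \<Rightarrow> ('a \<Rightarrow> 'b) \<Rightarrow> 'a \<Rightarrow> 'b"
  where "scaleR_fun c f = (\<lambda>i. c *\<^sub>R f i)"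

instance
  by standard (simp_all add: scaleR_fun_def fun_eq_iff scaleR_add_right scaleR_add_left)

end

(* The plain "- A" on sets is the complement. *)
definition antipodal :: "(nat \<Rightarrow> real) set \<Rightarrow> (nat \<Rightarrow> real) set"
  where "antipodal A = uminus ` A"

end

theory Submission
  imports Defs "HOL-Homology.Invariance_of_Domain"
begin

(* The arrow of exact sequences would make every statement about limits ambiguous. *)
no_notation exact_seq_arrow (\<open>(\<open>indent=3 notation=\<open>mixfix exact_seq\<close>\<close>_ / \<longlongrightarrow>\<index> _)\<close> [1000, 60])

text \<open>
  A signed colour is a triple of a colour \<open>w\<close>, an index \<open>i\<close> and a sign \<open>s\<close>; it is present at \<open>z\<close> if
  \<open>z\<close> lies in \<open>s A\<^sup>w\<^sub>i\<close>, and it carries the vector \<open>s (x\<^sup>w\<^sub>i, 1)\<close> of \<open>\<real>\<^sup>d\<close>. The theorem asks for a point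
  of the sphere at which \<open>d + 1\<close> signed colours with pairwise different \<open>w\<close> are present whose
  vectors have \<open>0\<close> in their convex hull: splitting such a combination by sign gives a common point of
  the two hulls, the last coordinate making the two total weights equal. Hypothesis (2) says that
  different colours present at the same point with the same index have the same sign, so the index
  sets of the two parts are automatically disjoint. Hypothesis (1) says that at every point at least
  \<open>d + 1\<close> colours are present, so a combination with fewer colours can be padded with weight \<open>0\<close>,
  while Caratheodory's theorem shortens a combination with more of them.

  A combination that uses each colour only once comes from the Borsuk-Ulam theorem. If the sphere
  is cut into small cells in a different way for each colour \<open>w\<close>, and every cell of colour \<open>w\<close> that
  meets some \<open>\<plusminus>A\<^sup>w\<^sub>i\<close> is given one signed colour found there, with antipodal choices on antipodal
  cells, then the sum over \<open>w\<close> of a bump function on the cell containing \<open>z\<close> times the vector chosen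
  for that cell is an odd continuous map into \<open>\<real>\<^sup>d\<close>. It has a zero. The combination found there is
  not trivial if at every point all but at most \<open>d\<close> of the bump functions are positive. Such cells
  exist, by an idea of Kolmogorov and Ostrand: project the sphere to the surface of the cube and cut
  each coordinate at a grid that depends on the colour, the grids of different colours being disjoint
  and avoiding \<open>\<plusminus>1\<close>. Every coordinate can then lie on the grid of only one colour, and one of the
  \<open>d + 1\<close> coordinates is \<open>\<plusminus>1\<close> and lies on none. As the mesh tends to \<open>0\<close>, one combinatorial pattern
  occurs infinitely often, and compactness yields a point at which its signed colours are present.

  The Borsuk-Ulam theorem follows from the fact that odd maps of a sphere to itself have odd degree.
  The inductive step compares the degree with that of the restriction to the equator, which must
  first be made invariant. The same cells do this: an odd map is homotopic to one that is piecewise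
  a positive combination of at most \<open>p\<close> of finitely many vectors on the equator of \<open>S\<^sup>p\<close>. The image of
  the equator then lies in finitely many hyperplanes, misses some direction, and can be pushed away
  from it into the equator.
\<close>

section \<open>Linear dependence and the theorem of Caratheodory\<close>

lemma homogeneous_system_nontrivial_solution:
  fixes a :: "'i \<Rightarrow> nat \<Rightarrow> real"
  assumes "finite I" "card I > m"
  shows "\<exists>\<mu>. (\<exists>i\<in>I. \<mu> i \<noteq> 0) \<and> (\<forall>r<m. (\<Sum>i\<in>I. \<mu> i * a i r) = 0)"
  using assms
proof (induction m arbitrary: I a)
  case 0
  then obtain i where "i \<in> I"
    by fastforce
  then show ?case
    by (intro exI[of _ "\<lambda>_. 1"]) auto
next
  case (Suc m)
  show ?case
  proof (cases "\<forall>i\<in>I. a i m = 0")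
    case True
    obtain \<mu> where \<mu>: "\<exists>i\<in>I. \<mu> i \<noteq> 0" "\<forall>r<m. (\<Sum>i\<in>I. \<mu> i * a i r) = 0"
      using Suc.IH[OF Suc.prems(1), of a] Suc.prems(2) by auto
    then show ?thesis
      using True by (intro exI[of _ \<mu>]) (auto simp: less_Suc_eq)
  next
    case False
    then obtain p where p: "p \<in> I" "a p m \<noteq> 0"
      by blast
    define b where "b = (\<lambda>i r. a i r - a i m / a p m * a p r)"
    have card: "finite (I - {p})" "card (I - {p}) > m"
      using Suc.prems p by auto
    obtain \<mu> where \<mu>: "\<exists>i\<in>I-{p}. \<mu> i \<noteq> 0" "\<forall>r<m. (\<Sum>i\<in>I-{p}. \<mu> i * b i r) = 0"
      using Suc.IH[OF card, of b] by auto
    define \<nu> where "\<nu> = \<mu>(p := - (\<Sum>i\<in>I-{p}. \<mu> i * a i m) / a p m)"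
    have "(\<Sum>i\<in>I. \<nu> i * a i r) = (\<Sum>i\<in>I-{p}. \<mu> i * b i r)" for r
    proof -
      have "(\<Sum>i\<in>I. \<nu> i * a i r) = \<nu> p * a p r + (\<Sum>i\<in>I-{p}. \<nu> i * a i r)"
        by (simp add: sum.remove[OF Suc.prems(1) p(1)])
      also have "(\<Sum>i\<in>I-{p}. \<nu> i * a i r) = (\<Sum>i\<in>I-{p}. \<mu> i * a i r)"
        by (intro sum.cong) (auto simp: \<nu>_def)
      also have "\<nu> p * a p r = - (\<Sum>i\<in>I-{p}. \<mu> i * (a i m / a p m * a p r))"
        unfolding \<nu>_def by (simp add: sum_divide_distrib sum_distrib_right mult.assoc flip: sum_negf)
      finally show ?thesis
        by (simp add: b_def algebra_simps sum_subtractf)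
    qed
    moreover have "(\<Sum>i\<in>I-{p}. \<mu> i * b i r) = 0" if "r < Suc m" for r
      using \<mu>(2) that p(2) by (auto simp: less_Suc_eq b_def)
    moreover have "\<exists>i\<in>I. \<nu> i \<noteq> 0"
      using \<mu>(1) by (auto simp: \<nu>_def)
    ultimately show ?thesis
      by (intro exI[of _ \<nu>]) auto
  qed
qed

text \<open>
  Among more than \<open>d + 1\<close> vectors there is a dependency with total weight \<open>0\<close>; subtracting the
  right multiple of it removes one vector from the combination.
\<close>

lemma caratheodory_zero:
  fixes v :: "'i \<Rightarrow> nat \<Rightarrow> real"
  assumes "finite P" and nn: "\<And>p. p \<in> P \<Longrightarrow> l p \<ge> 0" and s1: "sum l P = 1"
    and z: "\<And>j. j < d \<Longrightarrow> (\<Sum>p\<in>P. l p * v p j) = 0"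
  shows "\<exists>Q l'. Q \<subseteq> P \<and> card Q \<le> d + 1 \<and> (\<forall>p\<in>Q. l' p \<ge> 0) \<and> sum l' Q = 1 \<and>
           (\<forall>j<d. (\<Sum>p\<in>Q. l' p * v p j) = 0)"
  using assms
proof (induction "card P" arbitrary: P l rule: less_induct)
  case less
  show ?case
  proof (cases "card P \<le> d + 1")
    case True
    then show ?thesis
      using less.prems by blast
  next
    case False
    \<comment> \<open>The extra constant coordinate keeps the total weight unchanged.\<close>
    define a where "a = (\<lambda>p j. if j < d then v p j else 1)"
    obtain \<mu>0 where \<mu>0: "\<exists>p\<in>P. \<mu>0 p \<noteq> 0" "\<forall>r<d+1. (\<Sum>p\<in>P. \<mu>0 p * a p r) = 0"
      using homogeneous_system_nontrivial_solution[of P "d+1" a] less.prems(1) False by auto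
    have \<mu>0s: "sum \<mu>0 P = 0"
      using \<mu>0(2)[rule_format, of d] by (simp add: a_def)
    have \<mu>0v: "(\<Sum>p\<in>P. \<mu>0 p * v p j) = 0" if "j < d" for j
      using \<mu>0(2)[rule_format, of j] that by (simp add: a_def)
    obtain p0 where p0: "p0 \<in> P" "\<mu>0 p0 > 0"
    proof (rule ccontr)
      assume "\<not> thesis"
      then have "\<forall>p\<in>P. \<mu>0 p \<le> 0"
        using that not_le by blast
      then have "\<forall>p\<in>P. \<mu>0 p = 0"
        using \<mu>0s less.prems(1) sum_nonneg_eq_0_iff[of P "\<lambda>p. - \<mu>0 p"] by (simp add: sum_negf)
      then show False
        using \<mu>0(1) by blast
    qed
    define T where "T = {p\<in>P. \<mu>0 p > 0}"
    have T: "finite T" "T \<noteq> {}"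
      using p0 less.prems(1) by (auto simp: T_def)
    obtain q where q: "q \<in> T" "\<And>p. p \<in> T \<Longrightarrow> l q / \<mu>0 q \<le> l p / \<mu>0 p"
      using arg_min_if_finite[OF T, of "\<lambda>p. l p / \<mu>0 p"] not_le by metis
    \<comment> \<open>The largest multiple of the dependency that can be subtracted with all weights nonnegative.\<close>
    define t where "t = l q / \<mu>0 q"
    have qP: "q \<in> P" "\<mu>0 q > 0"
      using q(1) by (auto simp: T_def)
    have t0: "t \<ge> 0"
      using less.prems(2)[OF qP(1)] qP(2) by (simp add: t_def)
    define l1 where "l1 = (\<lambda>p. l p - t * \<mu>0 p)"
    have l1q: "l1 q = 0"
      using qP by (simp add: l1_def t_def)
    have nn1: "l1 p \<ge> 0" if "p \<in> P" for p
    proof (cases "\<mu>0 p > 0")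
      case True
      then have "t \<le> l p / \<mu>0 p"
        using q(2)[of p] that by (auto simp: T_def t_def)
      then show ?thesis
        using True by (simp add: l1_def field_simps)
    next
      case False
      then have "t * \<mu>0 p \<le> 0"
        using t0 by (simp add: mult_nonneg_nonpos)
      then show ?thesis
        using less.prems(2)[OF that] by (simp add: l1_def)
    qed
    have drop: "(\<Sum>p\<in>P-{q}. l1 p * w p) = (\<Sum>p\<in>P. l1 p * w p)" for w
      using less.prems(1) qP l1q by (simp add: sum_diff1)
    have "card (P - {q}) < card P"
      using less.prems(1) qP by (meson card_Diff1_less)
    moreover have "finite (P - {q})"
      using less.prems(1) by simp
    moreover have "l1 p \<ge> 0" if "p \<in> P - {q}" for p
      using nn1 that by auto
    moreover have "sum l1 (P - {q}) = 1"
      using drop[of "\<lambda>_. 1"] less.prems(3) \<mu>0s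
      by (simp add: l1_def sum_subtractf flip: sum_distrib_left)
    moreover have "(\<Sum>p\<in>P-{q}. l1 p * v p j) = 0" if "j < d" for j
    proof -
      have "(\<Sum>p\<in>P. l1 p * v p j) = (\<Sum>p\<in>P. l p * v p j) - t * (\<Sum>p\<in>P. \<mu>0 p * v p j)"
        by (simp add: l1_def algebra_simps sum_subtractf sum_distrib_left)
      then show ?thesis
        using drop \<mu>0v[OF that] less.prems(4)[OF that] by simp
    qed
    ultimately obtain Q l' where "Q \<subseteq> P - {q}" "card Q \<le> d + 1 \<and> (\<forall>p\<in>Q. l' p \<ge> 0) \<and> sum l' Q = 1 \<and>
           (\<forall>j<d. (\<Sum>p\<in>Q. l' p * v p j) = 0)"
      using less.hyps[of "P - {q}" l1] by blast
    then show ?thesis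
      by blast
  qed
qed

section \<open>The sphere\<close>

lemma in_nsphere: "x \<in> topspace (nsphere p) \<longleftrightarrow> (\<Sum>i\<le>p. (x i)\<^sup>2) = 1 \<and> (\<forall>i>p. x i = 0)"
  by (simp add: nsphere)

lemma nsphere_eq_top_of_set: "nsphere p = top_of_set (topspace (nsphere p))"
  by (simp add: nsphere euclidean_product_topology)

lemma continuous_map_nsphere_real:
  "continuous_map (nsphere p) euclideanreal f \<longleftrightarrow> continuous_on (topspace (nsphere p)) f"
  by (subst nsphere_eq_top_of_set) simp

lemma uminus_in_nsphere [simp]: "- x \<in> topspace (nsphere p) \<longleftrightarrow> x \<in> topspace (nsphere p)"
  by (simp add: in_nsphere)

lemma tendsto_fun_iff:
  fixes f :: "'a \<Rightarrow> 'b \<Rightarrow> real"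
  shows "(f \<longlongrightarrow> l) F \<longleftrightarrow> (\<forall>i. ((\<lambda>x. f x i) \<longlongrightarrow> l i) F)"
  using limitin_componentwise[of "\<lambda>_. euclideanreal" UNIV f l F]
  by (simp add: euclidean_product_topology limitin_canonical_iff PiE_UNIV_domain)

lemma continuous_on_coordinate: "continuous_on S (\<lambda>x::'a \<Rightarrow> real. x j)"
  by (rule continuous_on_subset[OF continuous_on_product_coordinates]) simp

lemma nsphere_coord_le_1:
  assumes "x \<in> topspace (nsphere p)" shows "\<bar>x i\<bar> \<le> 1"
proof (cases "i \<le> p")
  case True
  have "(x i)\<^sup>2 \<le> (\<Sum>i\<le>p. (x i)\<^sup>2)"
    using True by (intro member_le_sum) auto
  then show ?thesis
    using assms by (simp add: in_nsphere abs_square_le_1)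
qed (use assms in \<open>auto simp: in_nsphere\<close>)

lemma seq_compact_nsphere: "seq_compact (topspace (nsphere p))"
proof -
  let ?S = "topspace (nsphere p)"
  have "closed ?S"
  proof -
    have eq: "?S = {x. (\<Sum>i\<le>p. (x i)\<^sup>2) = 1} \<inter> (\<Inter>i\<in>{p<..}. {x. x i = 0})"
      by (auto simp: in_nsphere)
    show ?thesis
      unfolding eq by (intro closed_Int closed_INT ballI closed_Collect_eq continuous_intros) auto
  qed
  have "compactin (powertop_real UNIV) (PiE UNIV (\<lambda>_. {-1..1}))"
    by (subst compactin_PiE) auto
  then have "compact (PiE UNIV (\<lambda>_::nat. {-1..1::real}))"
    by (simp add: euclidean_product_topology)
  moreover have "?S \<subseteq> PiE UNIV (\<lambda>_. {-1..1})"
    using nsphere_coord_le_1 by (fastforce simp: abs_le_iff)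
  ultimately have "compact ?S"
    using \<open>closed ?S\<close> compact_Int_closed by (metis inf.absorb_iff2)
  then show ?thesis
    by (rule compact_imp_seq_compact)
qed

section \<open>Projection to the surface of the cube\<close>

definition cube_norm :: "nat \<Rightarrow> (nat \<Rightarrow> real) \<Rightarrow> real"
  where "cube_norm p x = Max ((\<lambda>j. \<bar>x j\<bar>) ` {..p})"

definition cube_point :: "nat \<Rightarrow> (nat \<Rightarrow> real) \<Rightarrow> nat \<Rightarrow> real"
  where "cube_point p x j = x j / cube_norm p x"

lemma cube_norm_0: "cube_norm 0 x = \<bar>x 0\<bar>"
  by (simp add: cube_norm_def)

lemma cube_norm_Suc: "cube_norm (Suc p) x = max \<bar>x (Suc p)\<bar> (cube_norm p x)"
  by (simp add: cube_norm_def atMost_Suc)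

lemma continuous_on_cube_norm: "continuous_on S (cube_norm p)"
proof (induction p)
  case 0
  then show ?case
    unfolding cube_norm_0[abs_def]
    by (intro continuous_on_rabs continuous_on_coordinate)
next
  case (Suc p)
  then show ?case
    unfolding cube_norm_Suc[abs_def]
    by (intro continuous_on_max continuous_on_rabs Suc continuous_on_coordinate)
qed

lemma cube_norm_minus [simp]: "cube_norm p (- x) = cube_norm p x"
  by (simp add: cube_norm_def)

lemma cube_point_minus [simp]: "cube_point p (- x) = - cube_point p x"
  by (simp add: cube_point_def fun_eq_iff)

lemma coord_le_cube_norm: "j \<le> p \<Longrightarrow> \<bar>x j\<bar> \<le> cube_norm p x"
  by (simp add: cube_norm_def)

lemma cube_norm_attained: "\<exists>j\<le>p. \<bar>x j\<bar> = cube_norm p x"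
proof -
  have "cube_norm p x \<in> (\<lambda>j. \<bar>x j\<bar>) ` {..p}"
    unfolding cube_norm_def by (intro Max_in) auto
  then show ?thesis
    by force
qed

lemma cube_norm_pos:
  assumes "x \<in> topspace (nsphere p)" shows "cube_norm p x > 0"
proof (rule ccontr)
  assume *: "\<not> ?thesis"
  have "x j = 0" if "j \<le> p" for j
    using * coord_le_cube_norm[OF that, of x] by linarith
  then show False
    using assms by (simp add: in_nsphere)
qed

lemma continuous_on_cube_point: "continuous_on (topspace (nsphere p)) (\<lambda>x. cube_point p x j)"
  unfolding cube_point_def
  by (intro continuous_on_divide continuous_on_cube_norm continuous_on_coordinate)
     (use cube_norm_pos in force)

lemma cube_point_le_1:
  assumes "x \<in> topspace (nsphere p)" "j \<le> p" shows "\<bar>cube_point p x j\<bar> \<le> 1"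
  using coord_le_cube_norm[OF assms(2), of x] cube_norm_pos[OF assms(1)]
  by (simp add: cube_point_def)

lemma cube_point_face:
  assumes "x \<in> topspace (nsphere p)"
  obtains j where "j \<le> p" "\<bar>cube_point p x j\<bar> = 1"
  using cube_norm_attained[of p x] cube_norm_pos[OF assms] that
  by (auto simp: cube_point_def)

text \<open>
  The projection is inverted by Euclidean normalisation. This inverse is what turns closeness of
  cube coordinates back into closeness on the sphere in the next lemma.
\<close>

lemma nsphere_eq_normalised_cube_point:
  assumes "x \<in> topspace (nsphere p)"
  shows "x j = (if j \<le> p then cube_point p x j / sqrt (\<Sum>i\<le>p. (cube_point p x i)\<^sup>2) else 0)"
proof -
  have "(\<Sum>i\<le>p. (cube_point p x i)\<^sup>2) = 1 / (cube_norm p x)\<^sup>2"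
    using assms by (simp add: cube_point_def power_divide in_nsphere flip: sum_divide_distrib)
  then have "sqrt (\<Sum>i\<le>p. (cube_point p x i)\<^sup>2) = 1 / cube_norm p x"
    using cube_norm_pos[OF assms] by (simp add: real_sqrt_divide)
  then show ?thesis
    using assms cube_norm_pos[OF assms] by (auto simp: cube_point_def in_nsphere)
qed

lemma cube_point_close_imp_tendsto:
  assumes X: "\<And>N. X N \<in> topspace (nsphere p)" and Z: "\<And>N. Z N \<in> topspace (nsphere p)"
    and x: "x \<in> topspace (nsphere p)" and lim: "X \<longlonglongrightarrow> x"
    and e: "e \<longlonglongrightarrow> 0"
    and close: "\<And>N j. j \<le> p \<Longrightarrow> \<bar>cube_point p (X N) j - cube_point p (Z N) j\<bar> \<le> e N"
  shows "Z \<longlonglongrightarrow> x"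
proof -
  have 1: "(\<lambda>N. cube_point p (X N) j) \<longlonglongrightarrow> cube_point p x j" for j
    using continuous_on_tendsto_compose[OF continuous_on_cube_point lim x] X by simp
  have 2: "(\<lambda>N. cube_point p (Z N) j) \<longlonglongrightarrow> cube_point p x j" if "j \<le> p" for j
  proof -
    have "(\<lambda>N. cube_point p (X N) j - cube_point p (Z N) j) \<longlonglongrightarrow> 0"
      by (rule Lim_null_comparison[OF _ e]) (use close[OF that] in auto)
    from tendsto_diff[OF 1[of j] this] show ?thesis
      by simp
  qed
  have "(\<Sum>i\<le>p. (cube_point p x i)\<^sup>2) > 0"
  proof -
    obtain j where j: "j \<le> p" "\<bar>cube_point p x j\<bar> = 1"
      using cube_point_face[OF x] .
    then have "(cube_point p x j)\<^sup>2 = 1"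
      by (metis power2_abs power_one)
    moreover have "(cube_point p x j)\<^sup>2 \<le> (\<Sum>i\<le>p. (cube_point p x i)\<^sup>2)"
      using j(1) by (intro member_le_sum) auto
    ultimately show ?thesis
      by linarith
  qed
  then have "(\<lambda>N. cube_point p (Z N) j / sqrt (\<Sum>i\<le>p. (cube_point p (Z N) i)\<^sup>2)) \<longlonglongrightarrow>
        cube_point p x j / sqrt (\<Sum>i\<le>p. (cube_point p x i)\<^sup>2)" if "j \<le> p" for j
    using that by (intro tendsto_intros 2) auto
  then have "(\<lambda>N. Z N j) \<longlonglongrightarrow> x j" for j
    by (subst nsphere_eq_normalised_cube_point[OF x], subst nsphere_eq_normalised_cube_point[OF Z]) auto
  then show ?thesis
    by (simp add: tendsto_fun_iff)
qed

section \<open>Small cells with odd labels\<close>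

text \<open>
  The grid of parameter \<open>\<theta>\<close> and mesh \<open>1 / N\<close> consists of the \<open>t\<close> with \<open>N t + \<theta>\<close> or \<open>N t - \<theta>\<close> an
  integer. It is symmetric about \<open>0\<close>, and this even function of \<open>t\<close> vanishes exactly on it.
\<close>

definition wall :: "nat \<Rightarrow> real \<Rightarrow> real \<Rightarrow> real"
  where "wall N \<theta> t = \<bar>sin (pi * (real N * t - \<theta>)) * sin (pi * (real N * t + \<theta>))\<bar>"

text \<open>
  A number for the interval of the complement of the grid that contains \<open>t\<close>. Pairing a ceiling with
  a floor makes it an odd function of \<open>t\<close>.
\<close>

definition slab :: "nat \<Rightarrow> real \<Rightarrow> real \<Rightarrow> int"
  where "slab N \<theta> t = \<lceil>real N * t - \<theta>\<rceil> + \<lfloor>real N * t + \<theta>\<rfloor>"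

lemma sin_pi_eq_0_iff: "sin (pi * r) = 0 \<longleftrightarrow> r \<in> \<int>"
  by (auto simp: sin_zero_iff_int2 Ints_def)

lemma wall_eq_0_iff: "wall N \<theta> t = 0 \<longleftrightarrow> real N * t - \<theta> \<in> \<int> \<or> real N * t + \<theta> \<in> \<int>"
  by (simp add: wall_def sin_pi_eq_0_iff)

lemma wall_minus [simp]: "wall N \<theta> (- t) = wall N \<theta> t"
proof -
  have "pi * (real N * (- t) - \<theta>) = - (pi * (real N * t + \<theta>))"
       "pi * (real N * (- t) + \<theta>) = - (pi * (real N * t - \<theta>))"
    by (simp_all add: algebra_simps)
  then show ?thesis
    unfolding wall_def by (simp only: sin_minus) (simp add: mult.commute)
qed

lemma slab_minus [simp]: "slab N \<theta> (- t) = - slab N \<theta> t"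
proof -
  have "real N * (- t) - \<theta> = - (real N * t + \<theta>)" "real N * (- t) + \<theta> = - (real N * t - \<theta>)"
    by (simp_all add: algebra_simps)
  then show ?thesis
    unfolding slab_def by (simp only: ceiling_minus floor_minus)
qed

lemma unit_interval_not_int:
  fixes a :: real
  assumes "0 < a" "a < 1" shows "a \<notin> \<int>"
  using assms by (auto simp: Ints_def)

lemma wall_nonzero_at_integer:
  assumes "0 < \<theta>" "\<theta> < 1/2" "t \<in> \<int>"
  shows "wall N \<theta> t \<noteq> 0"
proof
  assume *: "wall N \<theta> t = 0"
  have "real N * t \<in> \<int>"
    using assms(3) by auto
  then have "\<theta> \<in> \<int>"
    using * unfolding wall_eq_0_iff
    by (metis Ints_diff add_diff_cancel_left' diff_diff_eq2 add.commute)
  then show False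
    using unit_interval_not_int[of \<theta>] assms by simp
qed

text \<open>
  Common points of the grids of \<open>\<theta>\<close> and \<open>\<theta>'\<close> would make \<open>\<theta> + \<theta>'\<close> or \<open>\<theta> - \<theta>'\<close> an integer. Parameters
  below \<open>1/2\<close> exclude the former.
\<close>

lemma wall_disjoint:
  assumes "0 < \<theta>" "\<theta> < 1/2" "0 < \<theta>'" "\<theta>' < 1/2" "wall N \<theta> t = 0" "wall N \<theta>' t = 0"
  shows "\<theta> = \<theta>'"
proof (rule ccontr)
  assume "\<theta> \<noteq> \<theta>'"
  define s where "s = real N * t"
  have "\<theta> + \<theta>' \<notin> \<int>"
    using assms by (intro unit_interval_not_int) auto
  moreover have "\<theta> - \<theta>' \<notin> \<int>" 
  proof
    assume "\<theta> - \<theta>' \<in> \<int>"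
    then have "\<bar>\<theta> - \<theta>'\<bar> \<in> \<int>"
      by simp
    then show False
      using unit_interval_not_int[of "\<bar>\<theta> - \<theta>'\<bar>"] assms \<open>\<theta> \<noteq> \<theta>'\<close> by fastforce
  qed
  moreover have "\<theta> + \<theta>' \<in> \<int> \<or> \<theta> - \<theta>' \<in> \<int>"
  proof -
    have 1: "s - \<theta> \<in> \<int> \<or> s + \<theta> \<in> \<int>" "s - \<theta>' \<in> \<int> \<or> s + \<theta>' \<in> \<int>"
      using assms(5,6) by (auto simp: wall_eq_0_iff s_def)
    have "s - \<theta> \<in> \<int> \<Longrightarrow> s - \<theta>' \<in> \<int> \<Longrightarrow> \<theta> - \<theta>' \<in> \<int>"
      using Ints_diff[of "s - \<theta>'" "s - \<theta>"] by simp
    moreover have "s - \<theta> \<in> \<int> \<Longrightarrow> s + \<theta>' \<in> \<int> \<Longrightarrow> \<theta> + \<theta>' \<in> \<int>"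
      using Ints_diff[of "s + \<theta>'" "s - \<theta>"] by (simp add: algebra_simps)
    moreover have "s + \<theta> \<in> \<int> \<Longrightarrow> s - \<theta>' \<in> \<int> \<Longrightarrow> \<theta> + \<theta>' \<in> \<int>"
      using Ints_diff[of "s + \<theta>" "s - \<theta>'"] by (simp add: algebra_simps)
    moreover have "s + \<theta> \<in> \<int> \<Longrightarrow> s + \<theta>' \<in> \<int> \<Longrightarrow> \<theta> - \<theta>' \<in> \<int>"
      using Ints_diff[of "s + \<theta>" "s + \<theta>'"] by simp
    ultimately show ?thesis
      using 1 by blast
  qed
  ultimately show False
    by blast
qed

text \<open>
  Both summands of the number of a slab are nondecreasing in \<open>t\<close>, so equal sums mean equal summands.
\<close>

lemma slab_eq_imp_close:
  assumes "slab N \<theta> s = slab N \<theta> t"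
  shows "real N * \<bar>s - t\<bar> \<le> 1"
proof -
  have *: "real N * t \<le> real N * s + 1" if "real N * s \<le> real N * t" "slab N \<theta> s = slab N \<theta> t" for s t
  proof -
    have "\<lceil>real N * s - \<theta>\<rceil> \<le> \<lceil>real N * t - \<theta>\<rceil>" "\<lfloor>real N * s + \<theta>\<rfloor> \<le> \<lfloor>real N * t + \<theta>\<rfloor>"
      using that(1) by (simp_all add: ceiling_mono floor_mono)
    then have "\<lceil>real N * s - \<theta>\<rceil> = \<lceil>real N * t - \<theta>\<rceil>"
      using that(2) unfolding slab_def by linarith
    then show ?thesis
      by linarith
  qed
  consider "s \<le> t" | "t \<le> s" by linarith
  then have "real N * (s - t) \<le> 1 \<and> real N * (t - s) \<le> 1"
  proof cases
    case 1
    then have "real N * s \<le> real N * t"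
      by (simp add: mult_left_mono)
    then show ?thesis
      using *[OF _ assms] by (simp add: algebra_simps)
  next
    case 2
    then have "real N * t \<le> real N * s"
      by (simp add: mult_left_mono)
    then show ?thesis
      using *[OF _ assms[symmetric]] by (simp add: algebra_simps)
  qed
  then show ?thesis
    by (simp add: abs_if)
qed

lemma slab_at_1:
  assumes "0 < \<theta>" "\<theta> < 1/2"
  shows "slab N \<theta> 1 = 2 * int N"
proof -
  have "\<lceil>real N - \<theta>\<rceil> = int N" "\<lfloor>real N + \<theta>\<rfloor> = int N"
    using assms by linarith+
  then show ?thesis
    by (simp add: slab_def)
qed

text \<open>
  The bump function of the cells: it vanishes exactly where some coordinate is on the grid. Cells are
  named by the numbers of the slabs of all coordinates, so antipodal cells have opposite names.
\<close>

definition cell_weight :: "nat \<Rightarrow> nat \<Rightarrow> real \<Rightarrow> (nat \<Rightarrow> real) \<Rightarrow> real"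
  where "cell_weight p N \<theta> x = (\<Prod>j\<le>p. wall N \<theta> (cube_point p x j))"

definition cell_label :: "nat \<Rightarrow> nat \<Rightarrow> real \<Rightarrow> (nat \<Rightarrow> real) \<Rightarrow> nat \<Rightarrow> int"
  where "cell_label p N \<theta> x j = (if j \<le> p then slab N \<theta> (cube_point p x j) else 0)"

lemma cell_weight_nonneg: "cell_weight p N \<theta> x \<ge> 0"
  unfolding cell_weight_def wall_def by (intro prod_nonneg) auto

lemma cell_weight_minus [simp]: "cell_weight p N \<theta> (- x) = cell_weight p N \<theta> x"
  by (simp add: cell_weight_def)

lemma cell_label_minus [simp]: "cell_label p N \<theta> (- x) = - cell_label p N \<theta> x"
  by (simp add: cell_label_def fun_eq_iff)

text \<open>
  A coordinate equal to \<open>\<plusminus>1\<close> lies in the slab with number \<open>\<plusminus>2 N\<close>. So no cell is its own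
  antipode, which leaves room for odd choices.
\<close>

lemma cell_label_nonzero:
  assumes "0 < \<theta>" "\<theta> < 1/2" "N \<ge> 1" "x \<in> topspace (nsphere p)"
  shows "cell_label p N \<theta> x \<noteq> 0"
proof -
  obtain j where j: "j \<le> p" "\<bar>cube_point p x j\<bar> = 1"
    using cube_point_face[OF assms(4)] .
  then have "cube_point p x j = 1 \<or> cube_point p x j = - 1"
    by linarith
  then have "cell_label p N \<theta> x j \<noteq> 0"
    using slab_at_1[OF assms(1,2), of N] slab_minus[of N \<theta> 1] assms(3) j(1)
    by (auto simp: cell_label_def)
  then show ?thesis
    by (auto simp: fun_eq_iff)
qed

lemma cell_label_eq_imp_close:
  assumes "cell_label p N \<theta> x = cell_label p N \<theta> z" "N \<ge> 1" "j \<le> p"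
  shows "\<bar>cube_point p x j - cube_point p z j\<bar> \<le> 1 / real N"
proof -
  have "slab N \<theta> (cube_point p x j) = slab N \<theta> (cube_point p z j)"
    using fun_cong[OF assms(1), of j] assms(3) by (simp add: cell_label_def)
  from slab_eq_imp_close[OF this] show ?thesis
    using assms(2) by (simp add: field_simps)
qed

lemma finite_cell_labels:
  assumes "0 < \<theta>" "\<theta> < 1/2"
  shows "finite (cell_label p N \<theta> ` topspace (nsphere p))"
proof -
  let ?B = "{-(2 * int N + 2)..2 * int N + 2}"
  have b: "slab N \<theta> t \<in> ?B" if "\<bar>t\<bar> \<le> 1" for t
  proof -
    have "\<bar>real N * t\<bar> \<le> real N"
      using that by (simp add: abs_mult mult_left_le)
    then have "- real N \<le> real N * t" "real N * t \<le> real N"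
      by linarith+
    then show ?thesis
      unfolding slab_def using assms by auto linarith+
  qed
  have "cell_label p N \<theta> ` topspace (nsphere p) \<subseteq>
          {f. \<forall>j. (j \<in> {..p} \<longrightarrow> f j \<in> ?B) \<and> (j \<notin> {..p} \<longrightarrow> f j = 0)}"
    using b[OF cube_point_le_1] by (auto simp: cell_label_def)
  then show ?thesis
    by (rule finite_subset) (intro finite_set_of_finite_funs; simp)
qed

text \<open>
  The covering property behind everything: a coordinate lies on the grid of at most one \<open>\<theta>\<close>, and an
  integral coordinate (on the cube: \<open>0\<close> or \<open>\<plusminus>1\<close>) on none. Taking for \<open>J\<close> all coordinates but one
  that is \<open>\<plusminus>1\<close> gives the bound \<open>p\<close>; on the equator a second coordinate can be left out.
\<close>

lemma few_cell_weights_vanish: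
  assumes inj: "inj_on \<theta> K" and \<theta>: "\<And>k. k \<in> K \<Longrightarrow> 0 < \<theta> k \<and> \<theta> k < 1/2"
    and x: "x \<in> topspace (nsphere p)"
    and J: "\<And>j. j \<le> p \<Longrightarrow> cube_point p x j \<notin> \<int> \<Longrightarrow> j \<in> J" and fin: "finite J"
  shows "card {k\<in>K. cell_weight p N (\<theta> k) x = 0} \<le> card J"
proof -
  let ?Z = "{k\<in>K. cell_weight p N (\<theta> k) x = 0}"
  have "\<forall>k\<in>?Z. \<exists>j. j \<le> p \<and> wall N (\<theta> k) (cube_point p x j) = 0"
    by (auto simp: cell_weight_def)
  then obtain f where f: "\<And>k. k \<in> ?Z \<Longrightarrow> f k \<le> p \<and> wall N (\<theta> k) (cube_point p x (f k)) = 0"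
    by metis
  show ?thesis
  proof (rule card_inj_on_le)
    show "inj_on f ?Z"
    proof (rule inj_onI)
      fix k l assume kl: "k \<in> ?Z" "l \<in> ?Z" "f k = f l"
      have "\<theta> k = \<theta> l"
        using wall_disjoint[of "\<theta> k" "\<theta> l" N "cube_point p x (f k)"] f[OF kl(1)] f[OF kl(2)] kl \<theta> by auto
      then show "k = l"
        using inj kl by (auto dest: inj_onD)
    qed
    show "f ` ?Z \<subseteq> J"
    proof clarify
      fix k assume k: "k \<in> K" "cell_weight p N (\<theta> k) x = 0"
      then have "f k \<le> p" "wall N (\<theta> k) (cube_point p x (f k)) = 0"
        using f[of k] by auto
      then show "f k \<in> J"
        using J wall_nonzero_at_integer \<theta>[OF k(1)] by blast
    qed
  qed fact
qed

lemma continuous_on_cell_weight: "continuous_on (topspace (nsphere p)) (cell_weight p N \<theta>)"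
proof -
  have "continuous_on UNIV (wall N \<theta>)"
    unfolding wall_def by (intro continuous_intros)
  then have "continuous_on (topspace (nsphere p)) (\<lambda>x. wall N \<theta> (cube_point p x j))" for j
    by (rule continuous_on_compose2) (auto intro: continuous_on_cube_point)
  then show ?thesis
    unfolding cell_weight_def by (rule continuous_on_prod)
qed

text \<open>
  Arbitrary choices made cell by cell become continuous when multiplied by the weight: inside a cell
  the label is locally constant, and at the walls the weight kills the finitely many values.
\<close>

lemma continuous_on_cell_weight_times:
  fixes h :: "(nat \<Rightarrow> int) \<Rightarrow> real"
  assumes "0 < \<theta>" "\<theta> < 1/2"
  shows "continuous_on (topspace (nsphere p)) (\<lambda>x. cell_weight p N \<theta> x * h (cell_label p N \<theta> x))"
  unfolding continuous_on_def
proof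
  fix x assume x: "x \<in> topspace (nsphere p)"
  let ?S = "topspace (nsphere p)" and ?w = "cell_weight p N \<theta>" and ?l = "cell_label p N \<theta>"
  have w: "(?w \<longlongrightarrow> ?w x) (at x within ?S)"
    using continuous_on_cell_weight x by (auto simp: continuous_on_def)
  have c: "((\<lambda>z. cube_point p z j) \<longlongrightarrow> cube_point p x j) (at x within ?S)" for j
    using continuous_on_cube_point x by (auto simp: continuous_on_def)
  show "((\<lambda>x. ?w x * h (?l x)) \<longlongrightarrow> ?w x * h (?l x)) (at x within ?S)"
  proof (cases "?w x = 0")
    case True
    have "finite ((\<lambda>z. \<bar>h (?l z)\<bar>) ` ?S)"
      using finite_imageI[OF finite_cell_labels[OF assms, of p N], of "\<lambda>c. \<bar>h c\<bar>"]
      by (simp add: image_image)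
    then obtain B where B: "\<And>z. z \<in> ?S \<Longrightarrow> \<bar>h (?l z)\<bar> \<le> B"
      by (meson Max_ge imageI)
    have "((\<lambda>x. ?w x * h (?l x)) \<longlongrightarrow> 0) (at x within ?S)"
    proof (rule Lim_null_comparison)
      show "\<forall>\<^sub>F z in at x within ?S. norm (?w z * h (?l z)) \<le> ?w z * B"
        unfolding eventually_at_filter
        by (auto intro!: always_eventually simp: abs_mult cell_weight_nonneg B mult_left_mono)
      show "((\<lambda>z. ?w z * B) \<longlongrightarrow> 0) (at x within ?S)"
        using tendsto_mult[OF w tendsto_const[of B]] True by simp
    qed
    then show ?thesis
      using True by simp
  next
    case False
    then have nz: "wall N \<theta> (cube_point p x j) \<noteq> 0" if "j \<le> p" for j
      using that by (auto simp: cell_weight_def)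
    have "\<forall>\<^sub>F z in at x within ?S. slab N \<theta> (cube_point p z j) = slab N \<theta> (cube_point p x j)" if "j \<le> p" for j
    proof -
      have "\<forall>\<^sub>F z in at x within ?S. \<lceil>real N * cube_point p z j - \<theta>\<rceil> = \<lceil>real N * cube_point p x j - \<theta>\<rceil>"
        by (rule eventually_ceiling_eq) (use nz[OF that] in \<open>auto simp: wall_eq_0_iff intro!: tendsto_intros c\<close>)
      moreover have "\<forall>\<^sub>F z in at x within ?S. \<lfloor>real N * cube_point p z j + \<theta>\<rfloor> = \<lfloor>real N * cube_point p x j + \<theta>\<rfloor>"
        by (rule eventually_floor_eq) (use nz[OF that] in \<open>auto simp: wall_eq_0_iff intro!: tendsto_intros c\<close>)
      ultimately show ?thesis
        by eventually_elim (simp add: slab_def)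
    qed
    then have "\<forall>\<^sub>F z in at x within ?S. \<forall>j\<in>{..p}. slab N \<theta> (cube_point p z j) = slab N \<theta> (cube_point p x j)"
      by (intro eventually_ball_finite) auto
    then have "\<forall>\<^sub>F z in at x within ?S. ?w z * h (?l x) = ?w z * h (?l z)"
    proof eventually_elim
      case (elim z)
      then have "?l z = ?l x"
        by (auto simp: cell_label_def fun_eq_iff)
      then show ?case
        by simp
    qed
    moreover have "((\<lambda>z. ?w z * h (?l x)) \<longlongrightarrow> ?w x * h (?l x)) (at x within ?S)"
      by (intro tendsto_intros w)
    ultimately show ?thesis
      by (rule Lim_transform_eventually[rotated])
  qed
qed

text \<open>Singles out one label of each pair of opposite nonzero labels.\<close>

definition leading_positive :: "(nat \<Rightarrow> int) \<Rightarrow> bool"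
  where "leading_positive c \<longleftrightarrow> c (LEAST j. c j \<noteq> 0) > 0"

lemma leading_positive_minus:
  assumes "c \<noteq> 0" shows "leading_positive (- c) \<longleftrightarrow> \<not> leading_positive c"
proof -
  obtain j where "c j \<noteq> 0"
    using assms by (auto simp: fun_eq_iff)
  then have "c (LEAST j. c j \<noteq> 0) \<noteq> 0"
    by (rule LeastI)
  then show ?thesis
    by (auto simp: leading_positive_def)
qed

text \<open>
  Choices are made on one of two opposite labels and transported to the other by \<open>flip\<close>, so they are
  consistent without any further care about ties.
\<close>

lemma odd_selection:
  fixes P :: "(nat \<Rightarrow> int) \<Rightarrow> 'a \<Rightarrow> bool"
  assumes inv: "\<And>v. flip (flip v) = v" and P: "\<And>c v. P c v \<Longrightarrow> P (- c) (flip v)"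
  obtains s where "\<And>c. c \<noteq> 0 \<Longrightarrow> s (- c) = flip (s c)"
    and "\<And>c v. c \<noteq> 0 \<Longrightarrow> P c v \<Longrightarrow> P c (s c)"
proof
  define s where "s = (\<lambda>c. if leading_positive c then (SOME v. P c v) else flip (SOME v. P (- c) v))"
  show "s (- c) = flip (s c)" if "c \<noteq> 0" for c
    using that leading_positive_minus[OF that] inv by (auto simp: s_def)
  show "P c (s c)" if "c \<noteq> 0" "P c v" for c v
  proof (cases "leading_positive c")
    case True
    then show ?thesis
      using that by (auto simp: s_def intro: someI)
  next
    case False
    have "P (- c) (SOME v. P (- c) v)"
      using P[OF that(2)] by (rule someI)
    from P[OF this] show ?thesis
      using False by (simp add: s_def)
  qed
qed

section \<open>Odd maps of spheres have odd degree\<close>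

definition radial :: "nat \<Rightarrow> (nat \<Rightarrow> real) \<Rightarrow> nat \<Rightarrow> real"
  where "radial p v j = (if j \<le> p then v j / sqrt (\<Sum>i\<le>p. (v i)\<^sup>2) else 0)"

lemma sum_squares_pos:
  fixes v :: "nat \<Rightarrow> real"
  assumes "j \<le> p" "v j \<noteq> 0" shows "(\<Sum>i\<le>p. (v i)\<^sup>2) > 0"
proof -
  have "0 < (v j)\<^sup>2"
    using assms(2) by simp
  also have "(v j)\<^sup>2 \<le> (\<Sum>i\<le>p. (v i)\<^sup>2)"
    using assms(1) by (intro member_le_sum) auto
  finally show ?thesis .
qed

lemma radial_in_nsphere:
  assumes "j \<le> p" "v j \<noteq> 0" shows "radial p v \<in> topspace (nsphere p)"
  using sum_squares_pos[of j p v] assms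
  by (auto simp: in_nsphere radial_def power_divide simp flip: sum_divide_distrib)

lemma radial_minus: "radial p (- v) = - radial p v"
  by (simp add: radial_def fun_eq_iff)

lemma radial_nsphere: "x \<in> topspace (nsphere p) \<Longrightarrow> radial p x = x"
  by (auto simp: radial_def in_nsphere fun_eq_iff)

lemma continuous_map_radial:
  assumes F: "\<And>j. j \<le> p \<Longrightarrow> continuous_map X euclideanreal (\<lambda>x. F x j)"
    and nz: "\<And>x. x \<in> topspace X \<Longrightarrow> \<exists>j\<le>p. F x j \<noteq> 0"
  shows "continuous_map X (nsphere p) (\<lambda>x. radial p (F x))"
proof -
  have "continuous_map X euclideanreal (\<lambda>x. radial p (F x) j)" for j
  proof (cases "j \<le> p")
    case True
    have pos: "(\<Sum>i\<le>p. (F x i)\<^sup>2) > 0" if "x \<in> topspace X" for x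
      using nz[OF that] sum_squares_pos by blast
    have "continuous_map X euclideanreal (\<lambda>x. \<Sum>i\<le>p. (F x i)\<^sup>2)"
      by (intro continuous_intros F) auto
    then have "continuous_map X euclideanreal (\<lambda>x. sqrt (\<Sum>i\<le>p. (F x i)\<^sup>2))"
      by (rule continuous_map_sqrt)
    then have "continuous_map X euclideanreal (\<lambda>x. F x j / sqrt (\<Sum>i\<le>p. (F x i)\<^sup>2))"
      using pos by (intro continuous_map_real_divide F True) force+
    then show ?thesis
      using True by (simp add: radial_def)
  qed (simp add: radial_def)
  then have "continuous_map X (powertop_real UNIV) (\<lambda>x. radial p (F x))"
    by (simp add: continuous_map_componentwise_UNIV)
  moreover have "radial p (F x) \<in> topspace (nsphere p)" if "x \<in> topspace X" for x
    using nz[OF that] radial_in_nsphere by blast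
  ultimately show ?thesis
    unfolding nsphere by (auto simp: continuous_map_in_subtopology)
qed

lemma degree_straight_line_homotopy:
  assumes F: "\<And>j. j \<le> p \<Longrightarrow> continuous_on (topspace (nsphere p)) (\<lambda>x. F x j)"
    and G: "\<And>j. j \<le> p \<Longrightarrow> continuous_on (topspace (nsphere p)) (\<lambda>x. G x j)"
    and nz: "\<And>x t. x \<in> topspace (nsphere p) \<Longrightarrow> 0 \<le> t \<Longrightarrow> t \<le> 1 \<Longrightarrow>
               \<exists>j\<le>p. (1 - t) * F x j + t * G x j \<noteq> 0"
  shows "Brouwer_degree2 p (\<lambda>x. radial p (F x)) = Brouwer_degree2 p (\<lambda>x. radial p (G x))"
proof (rule Brouwer_degree2_homotopic)
  let ?I = "top_of_set {0..1::real}"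
  define H where "H = (\<lambda>z. radial p (\<lambda>j. (1 - fst z) * F (snd z) j + fst z * G (snd z) j))"
  have cF: "continuous_map (prod_topology ?I (nsphere p)) euclideanreal (\<lambda>z. F (snd z) j)" if "j \<le> p" for j
    using continuous_map_compose[OF continuous_map_snd, where g = "\<lambda>x. F x j"] F[OF that]
    unfolding o_def continuous_map_nsphere_real[symmetric] by blast
  have cG: "continuous_map (prod_topology ?I (nsphere p)) euclideanreal (\<lambda>z. G (snd z) j)" if "j \<le> p" for j
    using continuous_map_compose[OF continuous_map_snd, where g = "\<lambda>x. G x j"] G[OF that]
    unfolding o_def continuous_map_nsphere_real[symmetric] by blast
  have ct: "continuous_map (prod_topology ?I (nsphere p)) euclideanreal fst"
    by (rule continuous_map_into_fulltopology[OF continuous_map_fst])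
  have "continuous_map (prod_topology ?I (nsphere p)) (nsphere p) H"
    unfolding H_def
    by (rule continuous_map_radial; (intro continuous_intros cF cG ct)?) (use nz in auto)
  then show "homotopic_with (\<lambda>x. True) (nsphere p) (nsphere p) (\<lambda>x. radial p (F x)) (\<lambda>x. radial p (G x))"
    by (subst homotopic_with) (auto simp: H_def intro!: exI[of _ H])
qed

text \<open>
  A hyperplane meets the moment curve \<open>(t\<^sup>p, \<dots>, t, 1)\<close> in the roots of a nonzero polynomial.
\<close>

lemma exists_point_off_hyperplanes:
  fixes U :: "(nat \<Rightarrow> real) set"
  assumes "finite U" and U: "\<And>u. u \<in> U \<Longrightarrow> \<exists>j\<le>p. u j \<noteq> 0"
  shows "\<exists>a::nat \<Rightarrow> real. a p = 1 \<and> (\<forall>u\<in>U. (\<Sum>j\<le>p. u j * a j) \<noteq> 0)"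
proof -
  define c where "c = (\<lambda>(u::nat \<Rightarrow> real) i. u (p - i))"
  have rev: "(\<Sum>j\<le>p. u j * t ^ (p - j)) = (\<Sum>i\<le>p. c u i * t ^ i)" for u and t :: real
    unfolding c_def by (rule sum.reindex_bij_witness[of _ "\<lambda>i. p - i" "\<lambda>i. p - i"]) auto
  have "finite {t. (\<Sum>i\<le>p. c u i * t ^ i) = 0}" if u: "u \<in> U" for u
  proof -
    obtain j where "j \<le> p" "u j \<noteq> 0"
      using U[OF u] by blast
    then have "c u (p - j) \<noteq> 0" "p - j \<le> p"
      by (auto simp: c_def)
    then show ?thesis
      using polyfun_finite_roots[of "c u" p] by blast
  qed
  then have "finite (\<Union>u\<in>U. {t. (\<Sum>i\<le>p. c u i * t ^ i) = 0})"
    using assms(1) by blast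
  then obtain t :: real where "t \<notin> (\<Union>u\<in>U. {t. (\<Sum>i\<le>p. c u i * t ^ i) = 0})"
    using ex_new_if_finite[OF infinite_UNIV_char_0] by blast
  then show ?thesis
    using rev by (intro exI[of _ "\<lambda>j. t ^ (p - j)"]) auto
qed

lemma orthogonal_vector_exists:
  fixes v :: "nat \<Rightarrow> nat \<Rightarrow> real"
  shows "\<exists>u. (\<exists>j\<le>p. u j \<noteq> 0) \<and> (\<forall>k<p. (\<Sum>j\<le>p. u j * v k j) = 0)"
  using homogeneous_system_nontrivial_solution[of "{..p}" p "\<lambda>j k. v k j"] by auto

text \<open>
  Images of sufficiently close points have positive inner product. Positive combinations of images of
  points of small cells at \<open>x\<close> therefore have positive inner product with \<open>f x\<close>, so that they and the
  segment joining them to \<open>f x\<close> avoid the origin.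
\<close>

lemma nearby_images_acute:
  assumes f: "continuous_map (nsphere p) (nsphere p) f"
  shows "\<exists>N\<ge>1. \<forall>x\<in>topspace (nsphere p). \<forall>z\<in>topspace (nsphere p).
           (\<forall>j\<le>p. \<bar>cube_point p x j - cube_point p z j\<bar> \<le> 1 / real N) \<longrightarrow>
           (\<Sum>j\<le>p. f x j * f z j) > 0"
proof (rule ccontr)
  let ?S = "topspace (nsphere p)"
  assume "\<not> ?thesis"
  then have "\<forall>N. \<exists>x z. x \<in> ?S \<and> z \<in> ?S \<and>
     (\<forall>j\<le>p. \<bar>cube_point p x j - cube_point p z j\<bar> \<le> 1 / real (Suc N)) \<and> (\<Sum>j\<le>p. f x j * f z j) \<le> 0"
    by (metis not_less le_add1 plus_1_eq_Suc)
  then obtain X Z where XZ: "\<And>N. X N \<in> ?S" "\<And>N. Z N \<in> ?S"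
     "\<And>N j. j \<le> p \<Longrightarrow> \<bar>cube_point p (X N) j - cube_point p (Z N) j\<bar> \<le> 1 / real (Suc N)"
     "\<And>N. (\<Sum>j\<le>p. f (X N) j * f (Z N) j) \<le> 0"
    by metis
  obtain l r where l: "l \<in> ?S" "strict_mono r" "(X \<circ> r) \<longlonglongrightarrow> l"
    using seq_compact_nsphere XZ(1) unfolding seq_compact_def by metis
  have "(\<lambda>N. 1 / real (Suc (r N))) \<longlonglongrightarrow> 0"
    using LIMSEQ_subseq_LIMSEQ[OF LIMSEQ_inverse_real_of_nat l(2)]
    by (simp add: o_def inverse_eq_divide)
  then have Zl: "(Z \<circ> r) \<longlonglongrightarrow> l"
    by (rule cube_point_close_imp_tendsto[of "X \<circ> r" p "Z \<circ> r", rotated 4]) (use XZ l in auto)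
  have cf: "continuous_on ?S (\<lambda>x. f x j)" for j
    using continuous_map_compose[OF f continuous_map_nsphere_projection[of p j]]
    by (simp add: continuous_map_nsphere_real o_def)
  have "(\<lambda>N. f ((X \<circ> r) N) j) \<longlonglongrightarrow> f l j" "(\<lambda>N. f ((Z \<circ> r) N) j) \<longlonglongrightarrow> f l j" for j
    by (rule continuous_on_tendsto_compose[OF cf]; use XZ l Zl in \<open>simp add: o_def\<close>)+
  then have "(\<lambda>N. \<Sum>j\<le>p. f ((X \<circ> r) N) j * f ((Z \<circ> r) N) j) \<longlonglongrightarrow> (\<Sum>j\<le>p. f l j * f l j)"
    by (intro tendsto_intros)
  then have "(\<Sum>j\<le>p. f l j * f l j) \<le> 0"
    by (rule LIMSEQ_le_const2) (use XZ(4) in auto)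
  moreover have "f l \<in> ?S"
    using f l(1) continuous_map_image_subset_topspace by blast
  ultimately show False
    by (simp add: in_nsphere power2_eq_square)
qed

lemma odd_degree_of_odd_map_0:
  assumes f: "continuous_map (nsphere 0) (nsphere 0) f"
    and o: "\<And>x. x \<in> topspace (nsphere 0) \<Longrightarrow> f (- x) = - f x"
  shows "odd (Brouwer_degree2 0 f)"
proof -
  let ?S = "topspace (nsphere 0)"
  define e where "e = (\<lambda>i::nat. if i = 0 then 1 else 0 :: real)"
  have "x = e \<or> x = - e" if "x \<in> ?S" for x
  proof -
    have "x 0 = 1 \<or> x 0 = - 1" "\<forall>i>0. x i = 0"
      using that by (auto simp: in_nsphere power2_eq_1_iff)
    then show ?thesis
      by (auto simp: e_def fun_eq_iff)
  qed
  moreover have "e \<in> ?S"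
    by (simp add: in_nsphere e_def)
  ultimately have S: "?S = {e, - e}"
    by auto
  have fe: "f e \<in> ?S"
    using f S continuous_map_image_subset_topspace by blast
  then consider "f e = e" | "f e = - e"
    using S by auto
  then show ?thesis
  proof cases
    case 1
    have "Brouwer_degree2 0 f = Brouwer_degree2 0 id"
      by (rule Brouwer_degree2_eq) (use S o[of e] 1 in auto)
    then show ?thesis
      by simp
  next
    case 2
    have "Brouwer_degree2 0 f = Brouwer_degree2 0 (\<lambda>x i. if i = 0 then - x i else x i)"
    proof (rule Brouwer_degree2_eq)
      fix x assume "x \<in> ?S"
      then have "x = e \<or> x = - e" "f (- e) = e"
        using S o[of e] 2 by auto
      moreover have "(\<lambda>i. if i = 0 then - e i else e i) = - e"
          "(\<lambda>i. if i = 0 then - (- e) i else (- e) i) = e"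
        by (auto simp: e_def)
      ultimately show "f x = (\<lambda>i. if i = 0 then - x i else x i)"
        using 2 by auto
    qed
    then show ?thesis
      by (simp add: Brouwer_degree2_reflection)
  qed
qed

text \<open>
  Grid parameters for the colours \<open>k < n\<close>: the denominator keeps them all below \<open>1/2\<close>.
\<close>

definition offset :: "nat \<Rightarrow> nat \<Rightarrow> real"
  where "offset n k = real (Suc k) / (2 * real n + 1)"

lemma offset: "k < n \<Longrightarrow> 0 < offset n k \<and> offset n k < 1/2"
  by (auto simp: offset_def field_simps)

lemma inj_offset: "inj_on (offset n) K"
  by (auto simp: inj_on_def offset_def field_simps)

text \<open>
  A straight line leads from \<open>f\<close> to a map \<open>G\<close> that combines, with the weights of \<open>p\<close> cell systems,
  values of \<open>f\<close> chosen oddly on the cells, and \<open>f\<close> itself with weight \<open>\<bar>x p\<bar>\<close>. On the equator, where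
  that last term is absent, at most \<open>p - 1\<close> of the cell weights vanish and \<open>G\<close> is nonzero; away
  from it the last term makes \<open>G\<close> nonzero even where all cell weights vanish. On the equator \<open>G\<close>
  takes values in finitely many hyperplanes, hence never along a suitable direction \<open>a\<close>. A second
  straight line then leads to a map \<open>H\<close> whose last coordinate vanishes on the equator.
\<close>

lemma odd_map_homotopic_to_equator_preserving:
  assumes p: "p \<ge> 1" and f: "continuous_map (nsphere p) (nsphere p) f"
    and o: "\<And>x. x \<in> topspace (nsphere p) \<Longrightarrow> f (- x) = - f x"
  obtains h where "continuous_map (nsphere p) (nsphere p) h"
    and "\<And>x. x \<in> topspace (nsphere p) \<Longrightarrow> h (- x) = - h x"
    and "\<And>x. x \<in> topspace (nsphere p) \<Longrightarrow> x p = 0 \<Longrightarrow> h x p = 0"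
    and "Brouwer_degree2 p h = Brouwer_degree2 p f"
proof -
  let ?S = "topspace (nsphere p)"
  have cf: "continuous_on ?S (\<lambda>x. f x j)" for j
    using continuous_map_compose[OF f continuous_map_nsphere_projection[of p j]]
    by (simp add: continuous_map_nsphere_real o_def)
  have fS: "f x \<in> ?S" if "x \<in> ?S" for x
    using f that continuous_map_image_subset_topspace by blast
  obtain N where N: "N \<ge> 1" and Npos: "\<And>x z. x \<in> ?S \<Longrightarrow> z \<in> ?S \<Longrightarrow>
       (\<And>j. j\<le>p \<Longrightarrow> \<bar>cube_point p x j - cube_point p z j\<bar> \<le> 1 / real N) \<Longrightarrow>
       (\<Sum>j\<le>p. f x j * f z j) > 0"
    using nearby_images_acute[OF f] by metis
  let ?\<theta> = "offset p"
  let ?l = "\<lambda>k. cell_label p N (?\<theta> k)" and ?w = "\<lambda>k. cell_weight p N (?\<theta> k)"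
  have "\<exists>s. \<forall>c. c \<noteq> 0 \<longrightarrow> s (- c) = - s c \<and> (\<forall>v. (\<exists>z\<in>?S. ?l k z = c \<and> v = f z) \<longrightarrow> (\<exists>z\<in>?S. ?l k z = c \<and> s c = f z))" for k
  proof -
    have *: "\<exists>z\<in>?S. ?l k z = - c \<and> - v = f z" if "\<exists>z\<in>?S. ?l k z = c \<and> v = f z" for c v
      using that o by (metis cell_label_minus uminus_in_nsphere)
    show ?thesis
      by (rule odd_selection[of uminus "\<lambda>c v. \<exists>z\<in>?S. ?l k z = c \<and> v = f z"])
         (use * in simp, use * in simp, metis)
  qed
  then obtain s where s: "\<And>k c. c \<noteq> 0 \<Longrightarrow> s k (- c) = - s k c"
    "\<And>k c v. c \<noteq> 0 \<Longrightarrow> \<exists>z\<in>?S. ?l k z = c \<Longrightarrow> \<exists>z\<in>?S. ?l k z = c \<and> s k c = f z"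
    by metis
  define V where "V = (\<lambda>k x. s k (?l k x))"
  have lnz: "?l k x \<noteq> 0" if "x \<in> ?S" "k < p" for k x
    using cell_label_nonzero[of "?\<theta> k" N x p] offset[OF that(2)] N that by simp
  have Vpos: "(\<Sum>j\<le>p. f x j * V k x j) > 0" if x: "x \<in> ?S" and k: "k < p" for k x
  proof -
    obtain z where z: "z \<in> ?S" "?l k z = ?l k x" "V k x = f z"
      using s(2)[OF lnz[OF x k]] x unfolding V_def by blast
    show ?thesis
      unfolding z(3) by (rule Npos[OF x z(1)]) (rule cell_label_eq_imp_close[OF z(2)[symmetric] N])
  qed
  have Vodd: "V k (- x) = - V k x" if "x \<in> ?S" "k < p" for k x
    using s(1)[OF lnz[OF that]] by (simp add: V_def)
  define G where "G = (\<lambda>x j. (\<Sum>k<p. ?w k x * V k x j) + \<bar>x p\<bar> * f x j)"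
  have cG: "continuous_on ?S (\<lambda>x. G x j)" for j
  proof -
    have "continuous_on ?S (\<lambda>x. ?w k x * V k x j)" if "k < p" for k
      unfolding V_def using offset[OF that]
      by (intro continuous_on_cell_weight_times[of "?\<theta> k" p N "\<lambda>c. s k c j"]) auto
    then have "continuous_on ?S (\<lambda>x. \<Sum>k<p. ?w k x * V k x j)"
      by (intro continuous_on_sum) simp
    moreover have "continuous_on ?S (\<lambda>x. \<bar>x p\<bar> * f x j)"
      by (rule continuous_on_mult[OF continuous_on_rabs[OF continuous_on_coordinate] cf])
    ultimately show ?thesis
      unfolding G_def by (rule continuous_on_add)
  qed
  have Godd: "G (- x) j = - G x j" if "x \<in> ?S" for x j
    using Vodd[OF that] o[OF that] by (simp add: G_def sum_negf)
  \<comment> \<open>On the equator both the last coordinate and one equal to \<open>\<plusminus>1\<close> lie on no grid.\<close>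
  have weight: "(\<Sum>k<p. ?w k x) + \<bar>x p\<bar> > 0" if x: "x \<in> ?S" for x
  proof (cases "x p = 0")
    case False
    then show ?thesis
      by (simp add: sum_nonneg cell_weight_nonneg add_nonneg_pos)
  next
    case True
    obtain i where i: "i \<le> p" "\<bar>cube_point p x i\<bar> = 1"
      using cube_point_face[OF x] .
    have ip: "i \<noteq> p"
      using i True by (auto simp: cube_point_def)
    have ni: "j \<in> {..p} - {p, i}" if "j \<le> p" "cube_point p x j \<notin> \<int>" for j
    proof -
      have "cube_point p x i \<in> \<int>"
        using i(2) by (metis Ints_1 Ints_minus abs_if add.inverse_inverse)
      moreover have "cube_point p x p \<in> \<int>"
        using True by (simp add: cube_point_def)
      ultimately show ?thesis
        using that by auto
    qed
    have "card {k\<in>{..<p}. ?w k x = 0} \<le> card ({..p} - {p, i})"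
      by (rule few_cell_weights_vanish[OF inj_offset _ x ni]) (use offset in auto)
    also have "\<dots> < p"
      using i ip by (simp add: card_Diff_subset)
    finally have few: "card {k\<in>{..<p}. ?w k x = 0} < p" .
    obtain k where k: "k < p" "?w k x \<noteq> 0"
    proof (rule ccontr)
      assume "\<not> thesis"
      then have "{k\<in>{..<p}. ?w k x = 0} = {..<p}"
        using that by blast
      then show False
        using few by (metis card_lessThan less_irrefl)
    qed
    then have "?w k x > 0"
      using cell_weight_nonneg[of p N "?\<theta> k" x] by linarith
    then have "(\<Sum>k<p. ?w k x) > 0"
      using k by (intro sum_pos2[of _ k]) (auto simp: cell_weight_nonneg)
    then show ?thesis
      by simp
  qed
  have fG: "(\<Sum>j\<le>p. f x j * ((1 - t) * f x j + t * G x j)) > 0" if x: "x \<in> ?S" and t: "0 \<le> t" "t \<le> 1" for x t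
  proof -
    have ff: "(\<Sum>j\<le>p. f x j * f x j) = 1"
      using fS[OF x] by (simp add: in_nsphere power2_eq_square)
    have 1: "(\<Sum>j\<le>p. f x j * G x j) = (\<Sum>k<p. ?w k x * (\<Sum>j\<le>p. f x j * V k x j)) + \<bar>x p\<bar> * (\<Sum>j\<le>p. f x j * f x j)"
    proof -
      have "(\<Sum>j\<le>p. f x j * G x j) = (\<Sum>j\<le>p. \<Sum>k<p. ?w k x * (f x j * V k x j)) + (\<Sum>j\<le>p. \<bar>x p\<bar> * (f x j * f x j))"
        unfolding G_def sum.distrib[symmetric]
        by (intro sum.cong refl) (simp add: distrib_left sum_distrib_left mult.left_commute)
      then show ?thesis
        by (subst (asm) sum.swap) (simp add: sum_distrib_left)
    qed
    have Gp: "(\<Sum>j\<le>p. f x j * G x j) > 0"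
    proof (cases "x p = 0")
      case False
      have "?w k x * (\<Sum>j\<le>p. f x j * V k x j) \<ge> 0" if "k < p" for k
        using Vpos[OF x that] cell_weight_nonneg[of p N "?\<theta> k" x] by (simp add: mult_nonneg_nonneg)
      then have "(\<Sum>k<p. ?w k x * (\<Sum>j\<le>p. f x j * V k x j)) \<ge> 0"
        by (intro sum_nonneg) simp
      then show ?thesis
        unfolding 1 ff using False by simp
    next
      case True
      then obtain k where k: "k < p" "?w k x \<noteq> 0"
        using weight[OF x] sum.neutral[of "{..<p}" "\<lambda>k. ?w k x"] by fastforce
      then have wk: "?w k x > 0"
        using cell_weight_nonneg[of p N "?\<theta> k" x] by linarith
      have "?w i x * (\<Sum>j\<le>p. f x j * V i x j) \<ge> 0" if "i < p" for i
        using Vpos[OF x that] cell_weight_nonneg[of p N "?\<theta> i" x] by (simp add: mult_nonneg_nonneg)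
      moreover have "?w k x * (\<Sum>j\<le>p. f x j * V k x j) > 0"
        using wk Vpos[OF x k(1)] by simp
      ultimately have "(\<Sum>k<p. ?w k x * (\<Sum>j\<le>p. f x j * V k x j)) > 0"
        using k(1) by (intro sum_pos2[of _ k]) simp_all
      then show ?thesis
        unfolding 1 using True by simp
    qed
    have "(\<Sum>j\<le>p. f x j * ((1 - t) * f x j + t * G x j)) = (1 - t) * (\<Sum>j\<le>p. f x j * f x j) + t * (\<Sum>j\<le>p. f x j * G x j)"
      by (simp add: sum_distrib_left algebra_simps sum.distrib sum_subtractf)
    also have "\<dots> > 0"
    proof (cases "t = 0")
      case False
      then show ?thesis
        using t Gp ff by (intro add_nonneg_pos) auto
    qed (simp add: ff)
    finally show ?thesis .
  qed
  have nz1: "\<exists>j\<le>p. (1 - t) * f x j + t * G x j \<noteq> 0" if "x \<in> ?S" "0 \<le> t" "t \<le> 1" for x t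
  proof (rule ccontr)
    assume "\<not> ?thesis"
    then have "(\<Sum>j\<le>p. f x j * ((1 - t) * f x j + t * G x j)) = 0"
      by (intro sum.neutral) auto
    then show False
      using fG[OF that] by simp
  qed
  have deg1: "Brouwer_degree2 p (\<lambda>x. radial p (f x)) = Brouwer_degree2 p (\<lambda>x. radial p (G x))"
    by (rule degree_straight_line_homotopy[OF cf cG nz1])
  have deg0: "Brouwer_degree2 p (\<lambda>x. radial p (f x)) = Brouwer_degree2 p f"
    by (rule Brouwer_degree2_eq) (use fS radial_nsphere in auto)
  \<comment> \<open>The tuples of labels that occur are finitely many, so finitely many normal vectors suffice.\<close>
  define T where "T = (\<lambda>x. \<lambda>k\<in>{..<p}. ?l k x) ` ?S"
  have "finite T"
  proof (rule finite_subset)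
    show "T \<subseteq> PiE {..<p} (\<lambda>k. ?l k ` ?S)"
      by (auto simp: T_def)
    show "finite (PiE {..<p} (\<lambda>k. ?l k ` ?S))"
      using offset finite_cell_labels by (intro finite_PiE) auto
  qed
  have "\<forall>\<tau>. \<exists>u. (\<exists>j\<le>p. u j \<noteq> 0) \<and> (\<forall>k<p. (\<Sum>j\<le>p. u j * s k (\<tau> k) j) = 0)"
    using orthogonal_vector_exists[of p "\<lambda>k. s k (\<tau> k)" for \<tau>] by (rule allI)
  then have "\<exists>n. \<forall>\<tau>. (\<exists>j\<le>p. n \<tau> j \<noteq> 0) \<and> (\<forall>k<p. (\<Sum>j\<le>p. n \<tau> j * s k (\<tau> k) j) = 0)"
    by (rule choice)
  then obtain n where "\<forall>\<tau>. (\<exists>j\<le>p. n \<tau> j \<noteq> 0) \<and> (\<forall>k<p. (\<Sum>j\<le>p. n \<tau> j * s k (\<tau> k) j) = 0)"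
    by (rule exE)
  then have n: "\<exists>j\<le>p. n \<tau> j \<noteq> 0" "k < p \<Longrightarrow> (\<Sum>j\<le>p. n \<tau> j * s k (\<tau> k) j) = 0" for \<tau> k
    by simp_all
  obtain a where a: "a p = 1" "\<And>u. u \<in> n ` T \<Longrightarrow> (\<Sum>j\<le>p. u j * a j) \<noteq> 0"
    using exists_point_off_hyperplanes[OF finite_imageI[OF \<open>finite T\<close>], of n p] n(1) by blast
  have equator: "\<exists>j<p. G x j \<noteq> a j * G x p" if x: "x \<in> ?S" "x p = 0" for x
  proof (rule ccontr)
    assume *: "\<not> ?thesis"
    define u where "u = n (\<lambda>k\<in>{..<p}. ?l k x)"
    have "u \<in> n ` T"
      using x by (auto simp: u_def T_def)
    then have ua: "(\<Sum>j\<le>p. u j * a j) \<noteq> 0"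
      by (rule a(2))
    have uV: "(\<Sum>j\<le>p. u j * V k x j) = 0" if "k < p" for k
      using n(2)[OF that, of "\<lambda>k\<in>{..<p}. ?l k x"] that by (simp add: u_def V_def)
    have "(\<Sum>j\<le>p. u j * G x j) = (\<Sum>j\<le>p. \<Sum>k<p. ?w k x * (u j * V k x j))"
      using x(2) by (simp add: G_def sum_distrib_left mult.left_commute)
    also have "\<dots> = (\<Sum>k<p. ?w k x * (\<Sum>j\<le>p. u j * V k x j))"
      by (subst sum.swap) (simp add: sum_distrib_left)
    finally have uG: "(\<Sum>j\<le>p. u j * G x j) = 0"
      using uV by simp
    have Ga: "G x j = a j * G x p" if "j \<le> p" for j
      using * a(1) that by (cases "j = p") auto
    have "(\<Sum>j\<le>p. u j * G x j) = (\<Sum>j\<le>p. (u j * a j) * G x p)"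
      by (intro sum.cong refl) (subst Ga, simp_all)
    also have "\<dots> = (\<Sum>j\<le>p. u j * a j) * G x p"
      by (simp add: sum_distrib_right)
    finally have "G x p = 0"
      using uG ua by simp
    moreover obtain j where "j \<le> p" "G x j \<noteq> 0"
      using nz1[OF x(1), of 1] by auto
    ultimately show False
      using Ga[of j] by simp
  qed
  \<comment> \<open>Shearing the direction \<open>a\<close> to the last axis keeps \<open>G\<close> nonzero; shrinking the last coordinate
      is then harmless as well, because on the equator the sheared \<open>G\<close> is never on that axis.\<close>
  define H where "H = (\<lambda>x j. if j < p then G x j - a j * G x p else \<bar>x p\<bar> * G x p)"
  have cH: "continuous_on ?S (\<lambda>x. H x j)" for j
    unfolding H_def
    by (cases "j < p")
       (simp_all add: continuous_on_diff[OF cG continuous_on_mult_left[OF cG]]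
          continuous_on_mult[OF continuous_on_rabs[OF continuous_on_coordinate] cG])
  have Hodd: "H (- x) = - H x" if "x \<in> ?S" for x
    using Godd[OF that] by (auto simp: H_def fun_eq_iff)
  have nz2: "\<exists>j\<le>p. (1 - t) * G x j + t * H x j \<noteq> 0" if x: "x \<in> ?S" and t: "0 \<le> t" "t \<le> 1" for x t
  proof (rule ccontr)
    assume *: "\<not> ?thesis"
    have j: "G x j = t * a j * G x p" if "j < p" for j
      using *[simplified, rule_format, of j] that by (simp add: H_def algebra_simps)
    have "((1 - t) + t * \<bar>x p\<bar>) * G x p = 0"
      using *[simplified, rule_format, of p] by (simp add: H_def algebra_simps)
    moreover have "G x p \<noteq> 0"
    proof
      assume "G x p = 0"
      then have "\<forall>j\<le>p. G x j = 0"
        using j by (metis le_neq_implies_less mult_zero_right)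
      then show False
        using nz1[OF x, of 1] by auto
    qed
    ultimately have "(1 - t) + t * \<bar>x p\<bar> = 0"
      by simp
    moreover have "t * \<bar>x p\<bar> \<ge> 0"
      using t by simp
    ultimately have "t = 1" "x p = 0"
      using t by (auto simp: add_nonneg_eq_0_iff)
    then show False
      using equator[OF x] j by auto
  qed
  have deg2: "Brouwer_degree2 p (\<lambda>x. radial p (G x)) = Brouwer_degree2 p (\<lambda>x. radial p (H x))"
    by (rule degree_straight_line_homotopy[OF cG cH nz2])
  show ?thesis
  proof (rule that[of "\<lambda>x. radial p (H x)"])
    show "continuous_map (nsphere p) (nsphere p) (\<lambda>x. radial p (H x))"
      by (rule continuous_map_radial) (use cH nz2[of _ 1] in \<open>auto simp: continuous_map_nsphere_real\<close>)
    show "radial p (H (- x)) = - radial p (H x)" if "x \<in> ?S" for x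
      using Hodd[OF that] radial_minus by simp
    show "radial p (H x) p = 0" if "x p = 0" for x
      using that by (simp add: radial_def H_def)
    show "Brouwer_degree2 p (\<lambda>x. radial p (H x)) = Brouwer_degree2 p f"
      using deg0 deg1 deg2 by simp
  qed
qed

text \<open>
  By Borsuk's step theorem, the degrees of an equator-preserving odd map and of its restriction to the
  equator have the same parity. On \<open>S\<^sup>0\<close> the only odd maps are the identity and the reflection.
\<close>

theorem odd_map_degree_odd:
  assumes "continuous_map (nsphere p) (nsphere p) f"
    and "\<And>x. x \<in> topspace (nsphere p) \<Longrightarrow> f (- x) = - f x"
  shows "odd (Brouwer_degree2 p f)"
  using assms
proof (induction p arbitrary: f)
  case 0
  then show ?case
    by (rule odd_degree_of_odd_map_0)
next
  case (Suc q)
  let ?p = "Suc q"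
  obtain h where h: "continuous_map (nsphere ?p) (nsphere ?p) h"
    "\<And>x. x \<in> topspace (nsphere ?p) \<Longrightarrow> h (- x) = - h x"
    "\<And>x. x \<in> topspace (nsphere ?p) \<Longrightarrow> x ?p = 0 \<Longrightarrow> h x ?p = 0"
    "Brouwer_degree2 ?p h = Brouwer_degree2 ?p f"
    by (rule odd_map_homotopic_to_equator_preserving[OF _ Suc.prems]) auto
  have sub: "x \<in> topspace (nsphere ?p) \<and> x ?p = 0" if "x \<in> topspace (nsphere q)" for x
    using that by (auto simp: in_nsphere)
  have sub': "x \<in> topspace (nsphere q)" if "x \<in> topspace (nsphere ?p)" "x ?p = 0" for x
    using topspace_nsphere_minus1[OF that] by simp
  have hq: "h x \<in> topspace (nsphere q)" if "x \<in> topspace (nsphere q)" for x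
    using sub[OF that] h(1,3) sub' continuous_map_image_subset_topspace by blast
  have "even (Brouwer_degree2 ?p h - Brouwer_degree2 (?p - Suc 0) h)"
    by (rule Borsuk_odd_mapping_degree_step[OF h(1)])
       (use h(2) hq in \<open>auto simp: fun_Compl_def\<close>)
  moreover have "odd (Brouwer_degree2 q h)"
  proof (rule Suc.IH)
    have "continuous_map (subtopology (nsphere ?p) {x. x ?p = 0}) (nsphere ?p) h"
      by (rule continuous_map_from_subtopology[OF h(1)])
    then have "continuous_map (nsphere q) (nsphere ?p) h"
      by (simp add: subtopology_nsphere_equator)
    then have "continuous_map (nsphere q) (subtopology (nsphere ?p) {x. x ?p = 0}) h"
      using hq sub by (auto simp: continuous_map_in_subtopology)
    then show "continuous_map (nsphere q) (nsphere q) h"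
      by (simp add: subtopology_nsphere_equator)
    show "h (- x) = - h x" if "x \<in> topspace (nsphere q)" for x
      using sub[OF that] h(2) by blast
  qed
  ultimately show ?case
    using h(4) by simp
qed

section \<open>The Borsuk-Ulam theorem\<close>

text \<open>
  Without a zero, normalising \<open>f\<close> gives an odd map into the equator. As a map of the whole sphere it
  is not onto and has degree \<open>0\<close>, which is not odd.
\<close>

theorem borsuk_ulam_odd:
  fixes f :: "(nat \<Rightarrow> real) \<Rightarrow> nat \<Rightarrow> real"
  assumes c: "\<And>j. j < d \<Longrightarrow> continuous_on (topspace (nsphere d)) (\<lambda>x. f x j)"
    and o: "\<And>x j. j < d \<Longrightarrow> x \<in> topspace (nsphere d) \<Longrightarrow> f (- x) j = - f x j"
  shows "\<exists>x\<in>topspace (nsphere d). \<forall>j<d. f x j = 0"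
proof (rule ccontr)
  let ?S = "\<lambda>p. topspace (nsphere p)"
  assume "\<not> ?thesis"
  then have nz: "\<exists>j<d. f x j \<noteq> 0" if "x \<in> ?S d" for x
    using that by blast
  have "d \<noteq> 0"
    using nz[OF in_topspace_nsphere] by auto
  then obtain q where q: "d = Suc q"
    using not0_implies_Suc by blast
  define g where "g = (\<lambda>x. radial q (f x))"
  have g: "continuous_map (nsphere d) (nsphere q) g"
    unfolding g_def
    by (rule continuous_map_radial) (use c nz q in \<open>auto simp: continuous_map_nsphere_real less_Suc_eq_le\<close>)
  have godd: "g (- x) = - g x" if "x \<in> ?S d" for x
    using o[OF _ that] q by (auto simp: g_def radial_def fun_eq_iff)
  have sub: "nsphere q = subtopology (nsphere d) {x. x d = 0}"
    by (simp add: q subtopology_nsphere_equator)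
  have "continuous_map (nsphere d) (nsphere d) g"
    using g unfolding sub continuous_map_in_subtopology by blast
  moreover have "g ` ?S d \<noteq> ?S d"
  proof
    assume *: "g ` ?S d = ?S d"
    have "(\<lambda>i. if i = d then 1 else 0) \<in> ?S d"
      by (simp add: in_nsphere if_distrib[of "\<lambda>x. x\<^sup>2"] cong: if_cong)
    then have "(\<lambda>i. if i = d then 1 else 0) \<in> g ` ?S d"
      unfolding * .
    then obtain x where "(\<lambda>i. if i = d then 1 else 0) = g x"
      by (rule imageE)
    from fun_cong[OF this, of d] show False
      by (simp add: g_def radial_def q)
  qed
  ultimately have "Brouwer_degree2 d g = 0"
    by (rule Brouwer_degree2_nonsurjective)
  moreover have "odd (Brouwer_degree2 d g)"
    using odd_map_degree_odd \<open>continuous_map (nsphere d) (nsphere d) g\<close> godd by blast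
  ultimately show False
    by simp
qed

section \<open>Signed colourful zero combinations\<close>

text \<open>
  Here \<open>Q w v z\<close> says that the signed index \<open>v\<close> of colour \<open>w\<close> is present at \<open>z\<close>, and \<open>flip\<close> changes the
  sign. At a fixed mesh the colours that enter the combination at \<open>x\<close> are present at some point of the
  cell of \<open>x\<close> only, not at \<open>x\<close> itself.
\<close>

lemma signed_combination_at_scale:
  fixes W :: "nat set" and Q :: "nat \<Rightarrow> 'v \<Rightarrow> (nat \<Rightarrow> real) \<Rightarrow> bool" and vec :: "nat \<Rightarrow> 'v \<Rightarrow> nat \<Rightarrow> real"
    and \<theta> :: "nat \<Rightarrow> real"
  assumes W: "finite W" and \<theta>: "inj_on \<theta> W" "\<And>w. w \<in> W \<Longrightarrow> 0 < \<theta> w \<and> \<theta> w < 1/2"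
    and flip: "\<And>v. flip (flip v) = v"
    and Qflip: "\<And>w v z. Q w v z \<Longrightarrow> Q w (flip v) (- z)"
    and vflip: "\<And>w v j. vec w (flip v) j = - vec w v j"
    and many: "\<And>x. x \<in> topspace (nsphere d) \<Longrightarrow> d < card {w\<in>W. \<exists>v. Q w v x}"
    and N: "N \<ge> 1"
  shows "\<exists>x\<in>topspace (nsphere d). \<exists>K l \<mu>. K \<subseteq> W \<and> K \<noteq> {} \<and>
     (\<forall>w\<in>K. \<mu> w > 0 \<and> (\<exists>z\<in>topspace (nsphere d). Q w (l w) z \<and>
        (\<forall>j\<le>d. \<bar>cube_point d x j - cube_point d z j\<bar> \<le> 1 / real N))) \<and>
     (\<forall>j<d. (\<Sum>w\<in>K. \<mu> w * vec w (l w) j) = 0)"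
proof -
  let ?S = "topspace (nsphere d)"
  let ?l = "\<lambda>w. cell_label d N (\<theta> w)" and ?g = "\<lambda>w. cell_weight d N (\<theta> w)"
  define P where "P = (\<lambda>w c v. \<exists>z\<in>?S. ?l w z = c \<and> Q w v z)"
  have Pflip: "P w (- c) (flip v)" if "P w c v" for w c v
    using that Qflip unfolding P_def by (metis cell_label_minus uminus_in_nsphere)
  have "\<exists>s. (\<forall>c. c \<noteq> 0 \<longrightarrow> s (- c) = flip (s c)) \<and> (\<forall>c v. c \<noteq> 0 \<longrightarrow> P w c v \<longrightarrow> P w c (s c))" for w
    by (rule odd_selection[of flip "P w"]) (use flip Pflip in blast)+
  then obtain s where s: "\<And>w c. c \<noteq> 0 \<Longrightarrow> s w (- c) = flip (s w c)"
    "\<And>w c v. c \<noteq> 0 \<Longrightarrow> P w c v \<Longrightarrow> P w c (s w c)"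
    by metis
  define act where "act = (\<lambda>w c. \<exists>v. P w c v)"
  have act_minus: "act w (- c) = act w c" for w c
    using Pflip unfolding act_def by (metis minus_minus)
  define h where "h = (\<lambda>j w c. if act w c then vec w (s w c) j else 0)"
  define F where "F = (\<lambda>x j. \<Sum>w\<in>W. ?g w x * h j w (?l w x))"
  have lnz: "?l w x \<noteq> 0" if "w \<in> W" "x \<in> ?S" for w x
    using cell_label_nonzero \<theta>(2) that N by blast
  have cF: "continuous_on ?S (\<lambda>x. F x j)" for j
    unfolding F_def using \<theta>(2) by (intro continuous_on_sum continuous_on_cell_weight_times) auto
  have hodd: "h j w (- c) = - h j w c" if "c \<noteq> 0" for j w c
    using that by (simp add: h_def act_minus s(1) vflip)
  have Fodd: "F (- x) j = - F x j" if "x \<in> ?S" for x j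
    using hodd[OF lnz[OF _ that]] by (simp add: F_def flip: sum_negf)
  obtain x where x: "x \<in> ?S" and Fx: "\<And>j. j < d \<Longrightarrow> F x j = 0"
    using borsuk_ulam_odd[of d F] cF Fodd by blast
  define K where "K = {w\<in>W. ?g w x > 0 \<and> act w (?l w x)}"
  \<comment> \<open>At \<open>x\<close> more than \<open>d\<close> colours are present but at most \<open>d\<close> weights vanish.\<close>
  have "K \<noteq> {}"
  proof -
    obtain i where i: "i \<le> d" "\<bar>cube_point d x i\<bar> = 1"
      using cube_point_face[OF x] .
    have "cube_point d x i \<in> \<int>"
      using i(2) by (metis Ints_1 Ints_minus abs_if add.inverse_inverse)
    then have ni: "j \<in> {..d} - {i}" if "j \<le> d" "cube_point d x j \<notin> \<int>" for j
      using that by auto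
    have "card {w\<in>W. ?g w x = 0} \<le> card ({..d} - {i})"
      by (rule few_cell_weights_vanish[OF \<theta> x ni]) auto
    also have "\<dots> = d"
      using i by simp
    also have "d < card {w\<in>W. \<exists>v. Q w v x}"
      by (rule many[OF x])
    finally have "\<not> {w\<in>W. \<exists>v. Q w v x} \<subseteq> {w\<in>W. ?g w x = 0}"
      using W card_mono[of "{w\<in>W. ?g w x = 0}" "{w\<in>W. \<exists>v. Q w v x}"] by auto
    then obtain w v where w: "w \<in> W" "Q w v x" "?g w x \<noteq> 0"
      by blast
    then have "?g w x > 0"
      using cell_weight_nonneg[of d N "\<theta> w" x] by linarith
    moreover have "act w (?l w x)"
      using w x unfolding act_def P_def by blast
    ultimately show ?thesis
      using w unfolding K_def by blast
  qed
  moreover have "(\<Sum>w\<in>K. ?g w x * vec w (s w (?l w x)) j) = 0" if "j < d" for j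
  proof -
    have "F x j = (\<Sum>w\<in>K. ?g w x * h j w (?l w x))"
      unfolding F_def
    proof (rule sum.mono_neutral_right[OF W])
      show "\<forall>w\<in>W - K. ?g w x * h j w (?l w x) = 0"
        using cell_weight_nonneg by (auto simp: K_def h_def not_less intro: antisym)
    qed (auto simp: K_def)
    also have "\<dots> = (\<Sum>w\<in>K. ?g w x * vec w (s w (?l w x)) j)"
      by (intro sum.cong) (auto simp: K_def h_def)
    finally show ?thesis
      using Fx[OF that] by simp
  qed
  moreover have "\<exists>z\<in>?S. Q w (s w (?l w x)) z \<and> (\<forall>j\<le>d. \<bar>cube_point d x j - cube_point d z j\<bar> \<le> 1 / real N)"
    if "w \<in> K" for w
  proof -
    have w: "w \<in> W" "act w (?l w x)"
      using that by (auto simp: K_def)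
    then have "P w (?l w x) (s w (?l w x))"
      using s(2)[OF lnz[OF w(1) x]] unfolding act_def by blast
    then obtain z where z: "z \<in> ?S" "?l w z = ?l w x" "Q w (s w (?l w x)) z"
      unfolding P_def by blast
    then show ?thesis
      using cell_label_eq_imp_close[OF z(2)[symmetric] N] by blast
  qed
  ultimately show ?thesis
    using x by (intro bexI[of _ x] exI[of _ K] exI[of _ "\<lambda>w. s w (?l w x)"] exI[of _ "\<lambda>w. ?g w x"])
       (auto simp: K_def)
qed

text \<open>
  Being witnessed at scale \<open>N\<close> gets harder as \<open>N\<close> grows, so instead of passing to a subsequence it
  suffices that one of finitely many patterns is witnessed at arbitrarily large scales.
\<close>

lemma antitone_pigeonhole:
  fixes R :: "nat \<Rightarrow> 'a \<Rightarrow> bool"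
  assumes "finite T" and ex: "\<And>N. \<exists>t\<in>T. R N t" and anti: "\<And>M N t. M \<le> N \<Longrightarrow> R N t \<Longrightarrow> R M t"
  shows "\<exists>t\<in>T. \<forall>N. R N t"
proof (rule ccontr)
  assume "\<not> ?thesis"
  then obtain f where f: "\<And>t. t \<in> T \<Longrightarrow> \<not> R (f t) t"
    by metis
  obtain t where t: "t \<in> T" "R (Max (f ` T)) t"
    using ex by blast
  then have "f t \<le> Max (f ` T)"
    using assms(1) by simp
  then show False
    using anti t f by blast
qed

text \<open>
  Only the colours, their signed indices and the existence of weights form the pattern, so no limit of
  weights has to be taken and they stay positive.
\<close>

lemma signed_combination_limit:
  fixes W :: "nat set" and Q :: "nat \<Rightarrow> 'v \<Rightarrow> (nat \<Rightarrow> real) \<Rightarrow> bool" and vec :: "nat \<Rightarrow> 'v \<Rightarrow> nat \<Rightarrow> real"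
    and \<theta> :: "nat \<Rightarrow> real"
  assumes W: "finite W" and \<theta>: "inj_on \<theta> W" "\<And>w. w \<in> W \<Longrightarrow> 0 < \<theta> w \<and> \<theta> w < 1/2"
    and flip: "\<And>v. flip (flip v) = v"
    and Qflip: "\<And>w v z. Q w v z \<Longrightarrow> Q w (flip v) (- z)"
    and vflip: "\<And>w v j. vec w (flip v) j = - vec w v j"
    and many: "\<And>x. x \<in> topspace (nsphere d) \<Longrightarrow> d < card {w\<in>W. \<exists>v. Q w v x}"
    and L: "finite L" "\<And>w v z. Q w v z \<Longrightarrow> v \<in> L"
    and closed: "\<And>w v Z z. w \<in> W \<Longrightarrow> (\<And>N::nat. Z N \<in> topspace (nsphere d) \<and> Q w v (Z N)) \<Longrightarrow> Z \<longlonglongrightarrow> z \<Longrightarrow>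
        z \<in> topspace (nsphere d) \<Longrightarrow> Q w v z"
  shows "\<exists>x\<in>topspace (nsphere d). \<exists>K l \<mu>. K \<subseteq> W \<and> K \<noteq> {} \<and>
     (\<forall>w\<in>K. \<mu> w > 0 \<and> Q w (l w) x) \<and> (\<forall>j<d. (\<Sum>w\<in>K. \<mu> w * vec w (l w) j) = 0)"
proof -
  let ?S = "topspace (nsphere d)"
  define close where "close = (\<lambda>N x z. \<forall>j\<le>d. \<bar>cube_point d x j - cube_point d z j\<bar> \<le> 1 / real (Suc N))"
  define R where "R = (\<lambda>N (K, l). K \<noteq> {} \<and>
      (\<exists>\<mu>. (\<forall>w\<in>K. \<mu> w > 0) \<and> (\<forall>j<d. (\<Sum>w\<in>K. \<mu> w * vec w (l w) j) = (0::real))) \<and>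
      (\<exists>x\<in>?S. \<forall>w\<in>K. \<exists>z\<in>?S. Q w (l w) z \<and> close N x z))"
  let ?T = "Sigma (Pow W) (\<lambda>K. PiE K (\<lambda>_. L))"
  have "\<exists>t\<in>?T. \<forall>N. R N t"
  proof (rule antitone_pigeonhole)
    show "finite ?T"
      using W L by (intro finite_SigmaI finite_PiE) (auto intro: finite_subset)
    show "\<exists>t\<in>?T. R N t" for N
    proof -
      obtain x K l \<mu> where xK: "x \<in> ?S" "K \<subseteq> W" "K \<noteq> {}"
        "\<And>w. w \<in> K \<Longrightarrow> \<mu> w > 0 \<and> (\<exists>z\<in>?S. Q w (l w) z \<and> close N x z)"
        "\<And>j. j < d \<Longrightarrow> (\<Sum>w\<in>K. \<mu> w * vec w (l w) j) = 0"
      proof -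
        have "\<exists>x\<in>?S. \<exists>K l \<mu>. K \<subseteq> W \<and> K \<noteq> {} \<and>
            (\<forall>w\<in>K. \<mu> w > 0 \<and> (\<exists>z\<in>?S. Q w (l w) z \<and> close N x z)) \<and>
            (\<forall>j<d. (\<Sum>w\<in>K. \<mu> w * vec w (l w) j) = 0)"
          unfolding close_def
          by (rule signed_combination_at_scale[of W \<theta> flip Q vec d "Suc N", OF W \<theta> flip Qflip vflip many]) auto
        then show thesis
          using that by blast
      qed
      have "l w \<in> L" if "w \<in> K" for w
        using xK(4)[OF that] L(2) by blast
      then have "(K, restrict l K) \<in> ?T"
        using xK(2) by auto
      moreover have "R N (K, restrict l K)"
      proof -
        have "\<exists>\<mu>. (\<forall>w\<in>K. \<mu> w > 0) \<and> (\<forall>j<d. (\<Sum>w\<in>K. \<mu> w * vec w (restrict l K w) j) = 0)"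
          using xK(4,5) by (intro exI[of _ \<mu>]) (simp cong: sum.cong)
        moreover have "\<exists>x\<in>?S. \<forall>w\<in>K. \<exists>z\<in>?S. Q w (restrict l K w) z \<and> close N x z"
          by (rule bexI[OF _ xK(1)]) (use xK(4) in simp)
        ultimately show ?thesis
          using xK(3) unfolding R_def by blast
      qed
      ultimately show ?thesis
        by blast
    qed
    show "R M t" if "M \<le> N" "R N t" for M N t
    proof -
      have "close M x z" if "close N x z" for x z
      proof -
        have "1 / real (Suc N) \<le> 1 / real (Suc M)"
          using \<open>M \<le> N\<close> by (simp add: frac_le)
        then show ?thesis
          using that unfolding close_def by (meson order_trans)
      qed
      then show ?thesis
        using that(2) unfolding R_def by (cases t) (auto, blast)
    qed
  qed
  then obtain K l where K: "K \<subseteq> W" and R: "\<And>N. R N (K, l)"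
    by blast
  obtain \<mu> where \<mu>: "K \<noteq> {}" "\<And>w. w \<in> K \<Longrightarrow> \<mu> w > 0" "\<And>j. j < d \<Longrightarrow> (\<Sum>w\<in>K. \<mu> w * vec w (l w) j) = 0"
    using R[of 0] unfolding R_def by auto
  have "\<forall>N. \<exists>x. x \<in> ?S \<and> (\<forall>w\<in>K. \<exists>z\<in>?S. Q w (l w) z \<and> close N x z)"
  proof
    fix N
    have "\<exists>x\<in>?S. \<forall>w\<in>K. \<exists>z\<in>?S. Q w (l w) z \<and> close N x z"
      using R[of N] unfolding R_def by simp
    then show "\<exists>x. x \<in> ?S \<and> (\<forall>w\<in>K. \<exists>z\<in>?S. Q w (l w) z \<and> close N x z)"
      by blast
  qed
  then obtain X where X: "\<And>N. X N \<in> ?S" "\<And>N w. w \<in> K \<Longrightarrow> \<exists>z\<in>?S. Q w (l w) z \<and> close N (X N) z"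
    by metis
  obtain x r where x: "x \<in> ?S" "strict_mono r" "(X \<circ> r) \<longlonglongrightarrow> x"
    using seq_compact_nsphere X(1) unfolding seq_compact_def by metis
  have "Q w (l w) x" if w: "w \<in> K" for w
  proof -
    have "\<forall>N. \<exists>z. z \<in> ?S \<and> Q w (l w) z \<and> close N (X N) z"
      using X(2)[OF w] by blast
    then obtain Z where Z: "\<And>N. Z N \<in> ?S" "\<And>N. Q w (l w) (Z N)" "\<And>N. close N (X N) (Z N)"
      by metis
    have "(\<lambda>N. 1 / real (Suc (r N))) \<longlonglongrightarrow> 0"
      using LIMSEQ_subseq_LIMSEQ[OF LIMSEQ_inverse_real_of_nat x(2)]
      by (simp add: o_def inverse_eq_divide)
    then have "(Z \<circ> r) \<longlonglongrightarrow> x"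
      by (rule cube_point_close_imp_tendsto[of "X \<circ> r" d "Z \<circ> r", rotated 4])
         (use X Z x close_def in auto)
    then show ?thesis
      by (intro closed[of w "Z \<circ> r"]) (use w K Z x in auto)
  qed
  then show ?thesis
    using x(1) K \<mu> by blast
qed

text \<open>
  Caratheodory's theorem leaves at most \<open>d + 1\<close> colours, and the colours present at \<open>x\<close> allow padding
  with weight \<open>0\<close> to exactly that number.
\<close>

lemma rainbow_zero_combination:
  fixes W :: "nat set" and Q :: "nat \<Rightarrow> 'v \<Rightarrow> (nat \<Rightarrow> real) \<Rightarrow> bool" and vec :: "nat \<Rightarrow> 'v \<Rightarrow> nat \<Rightarrow> real"
  assumes W: "finite W"
    and many: "\<And>x. x \<in> topspace (nsphere d) \<Longrightarrow> d < card {w\<in>W. \<exists>v. Q w v x}"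
    and zero: "\<exists>x\<in>topspace (nsphere d). \<exists>K l \<mu>. K \<subseteq> W \<and> K \<noteq> {} \<and>
     (\<forall>w\<in>K. \<mu> w > 0 \<and> Q w (l w) x) \<and> (\<forall>j<d. (\<Sum>w\<in>K. \<mu> w * vec w (l w) j) = 0)"
  obtains x K l \<mu> where "x \<in> topspace (nsphere d)" "K \<subseteq> W" "card K = d + 1"
    "\<And>w. w \<in> K \<Longrightarrow> Q w (l w) x" "\<And>w. w \<in> K \<Longrightarrow> \<mu> w \<ge> 0" "sum \<mu> K = (1::real)"
    "\<And>j. j < d \<Longrightarrow> (\<Sum>w\<in>K. \<mu> w * vec w (l w) j) = 0"
proof -
  obtain x K l \<mu> where x: "x \<in> topspace (nsphere d)" and K: "K \<subseteq> W" "K \<noteq> {}"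
    and \<mu>: "\<And>w. w \<in> K \<Longrightarrow> \<mu> w > 0" "\<And>w. w \<in> K \<Longrightarrow> Q w (l w) x"
    "\<And>j. j < d \<Longrightarrow> (\<Sum>w\<in>K. \<mu> w * vec w (l w) j) = 0"
    using zero by blast
  have fin: "finite K"
    using K W finite_subset by blast
  have pos: "sum \<mu> K > 0"
    using \<mu>(1) K(2) fin by (simp add: sum_pos)
  define \<rho> where "\<rho> = (\<lambda>w. \<mu> w / sum \<mu> K)"
  have "\<exists>Q l'. Q \<subseteq> K \<and> card Q \<le> d + 1 \<and> (\<forall>p\<in>Q. l' p \<ge> 0) \<and> sum l' Q = 1 \<and>
           (\<forall>j<d. (\<Sum>p\<in>Q. l' p * vec p (l p) j) = 0)"
  proof (rule caratheodory_zero[OF fin, of \<rho>])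
    show "\<rho> w \<ge> 0" if "w \<in> K" for w
      using \<mu>(1)[OF that] pos by (simp add: \<rho>_def)
    show "sum \<rho> K = 1"
      using pos by (simp add: \<rho>_def flip: sum_divide_distrib)
    show "(\<Sum>w\<in>K. \<rho> w * vec w (l w) j) = 0" if "j < d" for j
      using \<mu>(3)[OF that] by (simp add: \<rho>_def flip: sum_divide_distrib)
  qed
  then obtain K1 \<nu> where K1: "K1 \<subseteq> K" "card K1 \<le> d + 1" "\<And>w. w \<in> K1 \<Longrightarrow> \<nu> w \<ge> 0" "sum \<nu> K1 = 1"
    "\<And>j. j < d \<Longrightarrow> (\<Sum>w\<in>K1. \<nu> w * vec w (l w) j) = 0"
    by blast
  let ?A = "{w\<in>W. \<exists>v. Q w v x}"
  have "K1 \<subseteq> ?A"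
    using K1(1) K(1) \<mu>(2) by blast
  moreover have "d + 1 \<le> card ?A"
    using many[OF x] by simp
  ultimately obtain K2 where K2: "K1 \<subseteq> K2" "K2 \<subseteq> ?A" "card K2 = d + 1"
    using exists_subset_between[of K1 "d+1" ?A] K1(2) W by auto
  define l2 where "l2 = (\<lambda>w. if w \<in> K1 then l w else (SOME v. Q w v x))"
  define \<nu>2 where "\<nu>2 = (\<lambda>w. if w \<in> K1 then \<nu> w else 0)"
  have fin2: "finite K2"
    using K2(2) W by (auto intro: finite_subset)
  have restr: "(\<Sum>w\<in>K2. \<nu>2 w * c w) = (\<Sum>w\<in>K1. \<nu> w * c w)" for c
    by (rule sum.mono_neutral_cong_right[OF fin2 K2(1)]) (auto simp: \<nu>2_def)
  show ?thesis
  proof (rule that[of x K2 l2 \<nu>2])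
    show "Q w (l2 w) x" if "w \<in> K2" for w
    proof (cases "w \<in> K1")
      case True
      then show ?thesis
        using \<mu>(2) K1(1) by (auto simp: l2_def)
    next
      case False
      have "\<exists>v. Q w v x"
        using that K2(2) by blast
      then show ?thesis
        using False someI_ex[of "\<lambda>v. Q w v x"] by (simp add: l2_def)
    qed
    show "sum \<nu>2 K2 = 1"
      using restr[of "\<lambda>_. 1"] K1(4) by simp
    show "(\<Sum>w\<in>K2. \<nu>2 w * vec w (l2 w) j) = 0" if "j < d" for j
      unfolding restr using K1(5)[OF that] by (simp add: l2_def cong: sum.cong)
  qed (use x K2 K1(3) in \<open>auto simp: \<nu>2_def\<close>)
qed

section \<open>Radon partitions from coverings of the sphere\<close>

lemma sum_fun_apply: "(\<Sum>w\<in>K. f w) j = (\<Sum>w\<in>K. f w j)"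
  for f :: "'a \<Rightarrow> 'b \<Rightarrow> 'c::comm_monoid_add"
  by (induction K rule: infinite_finite_induct) simp_all

lemma antipodal_iff: "y \<in> antipodal S \<longleftrightarrow> - y \<in> S"
  unfolding antipodal_def by (metis image_iff minus_minus)

theorem corollary2:
  fixes d m n :: nat
    and x :: "nat \<Rightarrow> nat \<Rightarrow> (nat \<Rightarrow> real)"
    and A :: "nat \<Rightarrow> nat \<Rightarrow> (nat \<Rightarrow> real) set"
  assumes "d \<ge> 1" and "m \<ge> 1" and "n \<ge> 1" and "n \<ge> d + 1"
    and "\<And>w i. w \<in> {1..n} \<Longrightarrow> i \<in> {1..m} \<Longrightarrow> x w i \<in> topspace (Euclidean_space (d - 1))"
    and "\<And>w i. w \<in> {1..n} \<Longrightarrow> i \<in> {1..m} \<Longrightarrow> closedin (nsphere d) (A w i)"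
    and "\<And>W'. W' \<subseteq> {1..n} \<Longrightarrow> card W' \<ge> n - d \<Longrightarrow>
           topspace (nsphere d) = (\<Union>w\<in>W'. \<Union>i\<in>{1..m}. A w i \<union> antipodal (A w i))"
    and "\<And>u w i. u \<in> {1..n} \<Longrightarrow> w \<in> {1..n} \<Longrightarrow> u \<noteq> w \<Longrightarrow> i \<in> {1..m} \<Longrightarrow>
           A u i \<inter> antipodal (A w i) = {}"
  shows "\<exists>Pp Pm. Pp \<subseteq> {1..n} \<times> {1..m} \<and> Pm \<subseteq> {1..n} \<times> {1..m} \<and> Pp \<inter> Pm = {} \<and>
           card Pp + card Pm = d + 1 \<and>
           inj_on fst (Pp \<union> Pm) \<and>
           snd ` Pp \<inter> snd ` Pm = {} \<and>
           convex hull {x w i |w i. (w, i) \<in> Pp} \<inter> convex hull {x w i |w i. (w, i) \<in> Pm} \<noteq> {} \<and>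
           (\<exists>y\<in>topspace (nsphere d).
              y \<in> (\<Inter>(w, i)\<in>Pp. A w i) \<inter> (\<Inter>(w, i)\<in>Pm. antipodal (A w i)))"
proof -
  note d1 = assms(1) and nd = assms(4) and xE = assms(5) and clA = assms(6)
    and cover = assms(7) and disj = assms(8)
  let ?S = "topspace (nsphere d)" and ?W = "{1..n}"
  define Q where "Q = (\<lambda>w (i, pos) z. i \<in> {1..m} \<and> (if pos then z \<in> A w i else - z \<in> A w i))"
  define vec where "vec = (\<lambda>w (i, pos) j. (if pos then 1 else - 1) * (if j < d - 1 then x w i j else 1))"
  define flip where "flip = (\<lambda>(i::nat, pos). (i, \<not> pos))"
  have many: "d < card {w\<in>?W. \<exists>v. Q w v z}" if z: "z \<in> ?S" for z
  proof (rule ccontr)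
    let ?H = "{w\<in>?W. \<exists>v. Q w v z}"
    assume "\<not> d < card ?H"
    then have "n - d \<le> card (?W - ?H)"
      by (subst card_Diff_subset) auto
    from cover[OF _ this] z obtain w i where wi: "w \<in> ?W - ?H" "i \<in> {1..m}" "z \<in> A w i \<union> antipodal (A w i)"
      by blast
    then have "Q w (i, True) z \<or> Q w (i, False) z"
      by (auto simp: Q_def antipodal_iff)
    then show False
      using wi(1) by blast
  qed
  have "\<exists>y\<in>?S. \<exists>K l \<mu>. K \<subseteq> ?W \<and> K \<noteq> {} \<and>
     (\<forall>w\<in>K. \<mu> w > 0 \<and> Q w (l w) y) \<and> (\<forall>j<d. (\<Sum>w\<in>K. \<mu> w * vec w (l w) j) = 0)"
  proof (rule signed_combination_limit[of ?W "\<lambda>w. offset n (w - 1)" flip Q vec d "{1..m} \<times> UNIV"])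
    show "inj_on (\<lambda>w. offset n (w - 1)) ?W"
      by (auto simp: inj_on_def offset_def field_simps)
    show "0 < offset n (w - 1) \<and> offset n (w - 1) < 1/2" if "w \<in> ?W" for w
      using that by (intro offset) auto
    show "flip (flip v) = v" for v
      by (simp add: flip_def split_beta)
    show "Q w (flip v) (- z)" if "Q w v z" for w v z
      using that by (auto simp: Q_def flip_def split: prod.splits)
    show "vec w (flip v) j = - vec w v j" for w v j
      by (simp add: vec_def flip_def split_beta)
    show "v \<in> {1..m} \<times> UNIV" if "Q w v z" for w v z
      using that by (auto simp: Q_def split: prod.splits)
    show "Q w v z" if w: "w \<in> ?W" and Z: "\<And>N::nat. Z N \<in> ?S \<and> Q w v (Z N)" "Z \<longlonglongrightarrow> z" and z: "z \<in> ?S" for w v Z z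
    proof -
      obtain i pos where v: "v = (i, pos)"
        by (cases v)
      have i: "i \<in> {1..m}"
        using Z(1) by (simp add: Q_def v)
      have "closedin (top_of_set ?S) (A w i)"
        using clA[OF w i] nsphere_eq_top_of_set by metis
      then obtain T where T: "closed T" "A w i = ?S \<inter> T"
        by (auto simp: closedin_closed)
      show ?thesis
      proof (cases pos)
        case True
        then have "\<And>N. Z N \<in> T"
          using Z(1) T(2) by (auto simp: Q_def v)
        then have "z \<in> T"
          using closed_sequentially[OF T(1)] Z(2) by blast
        then show ?thesis
          using True T z i by (auto simp: Q_def v)
      next
        case False
        then have "\<And>N. - Z N \<in> T"
          using Z(1) T(2) by (auto simp: Q_def v)
        moreover have "(\<lambda>N. - Z N) \<longlonglongrightarrow> - z"
          using Z(2) by (simp add: tendsto_fun_iff tendsto_minus)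
        ultimately have "- z \<in> T"
          using closed_sequentially[OF T(1), of "\<lambda>N. - Z N"] by blast
        then show ?thesis
          using False T z i by (auto simp: Q_def v)
      qed
    qed
  qed (use many in auto)
  then obtain y K l \<mu> where y: "y \<in> ?S" and K: "K \<subseteq> ?W" "card K = d + 1"
    and Ql: "\<And>w. w \<in> K \<Longrightarrow> Q w (l w) y" and \<mu>0: "\<And>w. w \<in> K \<Longrightarrow> \<mu> w \<ge> 0"
    and \<mu>1: "sum \<mu> K = (1::real)" and \<mu>v: "\<And>j. j < d \<Longrightarrow> (\<Sum>w\<in>K. \<mu> w * vec w (l w) j) = 0"
    using rainbow_zero_combination[of ?W d Q vec] many by blast
  define I where "I = (\<lambda>w. fst (l w))"
  define Kp where "Kp = {w\<in>K. snd (l w)}"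
  define Km where "Km = {w\<in>K. \<not> snd (l w)}"
  have finK: "finite K"
    using K(1) finite_subset by blast
  have KK: "K = Kp \<union> Km" "Kp \<inter> Km = {}" "finite Kp" "finite Km"
    using finK by (auto simp: Kp_def Km_def)
  have I: "I w \<in> {1..m}" if "w \<in> K" for w
    using Ql[OF that] by (auto simp: Q_def I_def split: prod.splits)
  have yp: "y \<in> A w (I w)" if "w \<in> Kp" for w
    using Ql[of w] that by (auto simp: Q_def I_def Kp_def split: prod.splits)
  have ym: "y \<in> antipodal (A w (I w))" if "w \<in> Km" for w
    using Ql[of w] that by (auto simp: Q_def I_def Km_def antipodal_iff split: prod.splits)
  \<comment> \<open>The coordinate \<open>d - 1\<close>, constantly \<open>1\<close>, compares the total weights of the two parts.\<close>
  define c where "c = (\<lambda>w j. if j < d - 1 then x w (I w) j else 1)"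
  have balance: "(\<Sum>w\<in>Kp. \<mu> w * c w j) = (\<Sum>w\<in>Km. \<mu> w * c w j)" if "j < d" for j
  proof -
    have "0 = (\<Sum>w\<in>K. \<mu> w * vec w (l w) j)"
      using \<mu>v[OF that] by simp
    also have "\<dots> = (\<Sum>w\<in>Kp. \<mu> w * vec w (l w) j) + (\<Sum>w\<in>Km. \<mu> w * vec w (l w) j)"
      unfolding KK(1) using KK by (intro sum.union_disjoint) auto
    also have "(\<Sum>w\<in>Kp. \<mu> w * vec w (l w) j) = (\<Sum>w\<in>Kp. \<mu> w * c w j)"
      by (intro sum.cong) (auto simp: Kp_def vec_def c_def I_def split: prod.splits)
    also have "(\<Sum>w\<in>Km. \<mu> w * vec w (l w) j) = - (\<Sum>w\<in>Km. \<mu> w * c w j)"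
      unfolding sum_negf[symmetric]
      by (intro sum.cong) (auto simp: Km_def vec_def c_def I_def split: prod.splits)
    finally show ?thesis
      by simp
  qed
  have "sum \<mu> Kp = sum \<mu> Km"
    using balance[of "d - 1"] d1 by (simp add: c_def)
  moreover have "sum \<mu> Kp + sum \<mu> Km = 1"
    using \<mu>1 KK by (metis sum.union_disjoint)
  ultimately have half: "(\<Sum>w\<in>Kp. 2 * \<mu> w) = 1" "(\<Sum>w\<in>Km. 2 * \<mu> w) = 1"
    by (simp_all flip: sum_distrib_left)
  define Pp where "Pp = (\<lambda>w. (w, I w)) ` Kp"
  define Pm where "Pm = (\<lambda>w. (w, I w)) ` Km"
  have inj: "inj_on (\<lambda>w. (w, I w)) X" for X
    by (auto simp: inj_on_def)
  have "snd ` Pp \<inter> snd ` Pm = {}"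
  proof -
    have "I u \<noteq> I w" if u: "u \<in> Kp" and w: "w \<in> Km" for u w
    proof
      assume eq: "I u = I w"
      have "u \<noteq> w" "u \<in> ?W" "w \<in> ?W" "I w \<in> {1..m}"
        using u w KK K(1) I by auto
      then have "A u (I w) \<inter> antipodal (A w (I w)) = {}"
        by (intro disj)
      then show False
        using yp[OF u] ym[OF w] eq by auto
    qed
    then show ?thesis
      by (auto simp: Pp_def Pm_def)
  qed
  moreover have "card Pp + card Pm = d + 1"
    unfolding Pp_def Pm_def using K(2) KK by (simp add: card_image[OF inj] card_Un_disjoint)
  moreover have "convex hull {x w i |w i. (w, i) \<in> Pp} \<inter> convex hull {x w i |w i. (w, i) \<in> Pm} \<noteq> {}"
  proof -
    let ?p = "\<Sum>w\<in>Kp. (2 * \<mu> w) *\<^sub>R x w (I w)" and ?q = "\<Sum>w\<in>Km. (2 * \<mu> w) *\<^sub>R x w (I w)"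
    have "?p \<in> convex hull {x w i |w i. (w, i) \<in> Pp}"
      by (rule convex_sum[OF KK(3) convex_convex_hull half(1)])
         (use \<mu>0 KK in \<open>auto simp: Pp_def intro!: hull_inc\<close>)
    moreover have "?q \<in> convex hull {x w i |w i. (w, i) \<in> Pm}"
      by (rule convex_sum[OF KK(4) convex_convex_hull half(2)])
         (use \<mu>0 KK in \<open>auto simp: Pm_def intro!: hull_inc\<close>)
    moreover have "?p = ?q"
    proof
      fix j
      show "?p j = ?q j"
      proof (cases "j < d - 1")
        case True
        then have "(\<Sum>w\<in>Kp. \<mu> w * x w (I w) j) = (\<Sum>w\<in>Km. \<mu> w * x w (I w) j)"
          using balance[of j] by (simp add: c_def)
        then show ?thesis
          by (simp add: sum_fun_apply scaleR_fun_def mult.assoc flip: sum_distrib_left)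
      next
        case False
        then have "x w (I w) j = 0" if "w \<in> K" for w
          using xE[of w "I w"] that K(1) I[OF that] by (auto simp: topspace_Euclidean_space)
        then show ?thesis
          using KK(1) by (simp add: sum_fun_apply scaleR_fun_def)
      qed
    qed
    ultimately show ?thesis
      by auto
  qed
  moreover have "Pp \<subseteq> {1..n} \<times> {1..m}" "Pm \<subseteq> {1..n} \<times> {1..m}"
    using KK K(1) I by (auto simp: Pp_def Pm_def)
  moreover have "Pp \<inter> Pm = {}" "inj_on fst (Pp \<union> Pm)"
    using KK(2) by (auto simp: Pp_def Pm_def inj_on_def)
  moreover have "y \<in> (\<Inter>(w, i)\<in>Pp. A w i) \<inter> (\<Inter>(w, i)\<in>Pm. antipodal (A w i))"
    using yp ym by (auto simp: Pp_def Pm_def)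
  ultimately show ?thesis
    using y by blast
qed

end
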